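(* Let $M$ be a hyperbolic $3$-manifold with totally geodesic boundary and let $\mathcal T$ be an ideal triangulation of $M$, with set of edges $E$ and set of tetrahedra $T$, that supports an angle structure. Then for all $b\in(0,1)$, the integral $$\mathrm{TV}_b(M,\mathcal T)=\int_{(\frac Q2+\mathbf i\mathbb R_{>0})^E}\prod_{e\in E}|e|_{\boldsymbol a}\prod_{\Delta\in T}|\Delta|_{\boldsymbol a}\,d\,\mathrm{Im}\,\boldsymbol a$$ converges absolutely.
   Context: **$b$-$6j$ symbols.** Let $b\in(0,1)$, $Q=b+b^{-1}$, $\mathbf i=\sqrt{-1}$. The double sine function is defined for $0<\mathrm{Re}\,z<Q$ by $S_b(z)=\exp\big(\int_\Omega\frac{\sinh((\frac Q2-z)t)}{4t\sinh(\frac{bt}{2})\sinh(\frac{t}{2b})}dt\big)$, where the contour $\Omega$ goes along the real line and passes above the pole at the origin; it extends meromorphically to $\mathbb C$ by $S_b(z+b^{\pm1})=2\sin(\pi b^{\pm1}z)S_b(z)$. For $a_1,\dots,a_6\in\frac Q2+\mathbf i\mathbb R_{>0}$ put $t_1=a_1+a_2+a_3$, $t_2=a_1+a_5+a_6$, $t_3=a_2+a_4+a_6$, $t_4=a_3+a_4+a_5$, $q_1=a_1+a_2+a_4+a_5$, $q_2=a_1+a_3+a_4+a_6$, $q_3=a_2+a_3+a_5+a_6$, $q_4=2Q$. The $b$-$6j$ symbol is $$\begin{Bmatrix} a_1 & a_2 & a_3 \\ a_4 & a_5 & a_6 \end{Bmatrix}_b=\Big(\frac{1}{\prod_{i,j=1}^4S_b(q_j-t_i)}\Big)^{1/2}\int_\Gamma\prod_{i=1}^4S_b(u-t_i)\prod_{j=1}^4S_b(q_j-u)\,d\,\mathrm{Im}\,u,$$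 where $\Gamma$ is any vertical line $\mathrm{Re}\,u=c$, $c\in(\frac{3Q}2,2Q)$ (absolutely convergent, independent of $c$), and the square root means $\exp(-\frac12\sum_{i,j}\log S_b(q_j-t_i))$ with $\log S_b$ given by the integral over $\Omega$ above. **Ideal triangulations.** A hyperbolic $3$-manifold with totally geodesic boundary is a compact $3$-manifold $M$ with nonempty boundary with a hyperbolic metric for which $\partial M$ is totally geodesic. An ideal triangulation $\mathcal T$ of $M$ is a realization of $M$ as the quotient of a finite set $T$ of truncated tetrahedra by homeomorphisms between pairs of (hexagonal) faces. $E$ is the set of edges of $\mathcal T$ (images of the edges of the tetrahedra, not of the truncation triangles). **State-integral.** For $\boldsymbol a=(a_e)_{e\in E}$ with $a_e=\frac Q2+\mathbf i\frac{l_e}{2\pi b}$, $l_e>0$: $|e|_{\boldsymbol a}=|S_b(2a_e)|^2=4\sinh(l_e)\sinh(l_e/b^2)$; for $\Delta\in T$, $|\Delta|_{\boldsymbol a}=\begin{Bmatrix} a_{e_1} & a_{e_2} & a_{e_3} \\ a_{e_4} & a_{e_5} & a_{e_6} \end{Bmatrix}_b$, where $e_1,e_2,e_3$ are the edges of a face of $\Delta$ and $e_i,e_{i+3}$ are opposite edges for $i=1,2,3$; $d\,\mathrm{Im}\,\boldsymbol a=\prod_ed\,\mathrm{Im}\,a_e$. **Angle structures.** An angle structure on $(M,\mathcal T)$ assigns to each edge of each tetrahedron of $T$ (each ``corner'') a number in $(0,\pi)$, the dihedral angle, so that in each tetrahedron the sum of the three dihedral angles at the edges adjacent to any vertex (triangle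 of truncation) is strictly less than $\pi$, and for each $e\in E$ the sum of the dihedral angles at all corners around $e$ is $2\pi$. *)

theory Defs
  imports "HOL-Complex_Analysis.Complex_Analysis"
begin

section \<open>The double sine function and the b-6j symbol\<close>

definition Qb :: "real \<Rightarrow> real" where
  "Qb b = b + 1 / b"

definition dsine_kernel :: "real \<Rightarrow> complex \<Rightarrow> complex \<Rightarrow> complex" where
  "dsine_kernel b z t =
     sinh ((of_real (Qb b) / 2 - z) * t) /
     (4 * t * sinh (of_real b * t / 2) * sinh (t / (2 * of_real b)))"

text \<open>The contour follows the real line and avoids the origin along the upper half circle of
  radius \<open>\<pi> b\<close>. For \<open>0 < b < 1\<close> the nonzero poles of the kernel closest to the origin are
  \<open>2 \<pi> \<i> b\<close> and \<open>- 2 \<pi> \<i> b\<close>, so every radius in \<open>(0, 2 \<pi> b)\<close> gives the same value.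
  The integral is meaningful only for \<open>0 < Re z < Qb b\<close>.\<close>

definition log_double_sine :: "real \<Rightarrow> complex \<Rightarrow> complex" where
  "log_double_sine b z =
     (LINT t:{..- (pi * b)}|lborel. dsine_kernel b z (complex_of_real t)) +
     contour_integral (part_circlepath 0 (pi * b) pi 0) (dsine_kernel b z) +
     (LINT t:{pi * b..}|lborel. dsine_kernel b z (complex_of_real t))"

text \<open>Outside the strip \<open>0 < Re z < Qb b\<close> the function is continued by
  \<open>S\<^sub>b(z + b) = 2 sin(\<pi> b z) S\<^sub>b(z)\<close>, applied as many times as needed to reach the strip from
  \<open>z\<close> (not at all inside the strip). This already determines the meromorphic extension. At its
  poles the value is \<open>0\<close>, by the convention for division by zero.\<close>

definition double_sine :: "real \<Rightarrow> complex \<Rightarrow> complex" where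
  "double_sine b z =
     (if 0 < Re z then
        let n = (LEAST n::nat. Re z - real n * b < Qb b) in
          (\<Prod>k=1..n. 2 * sin (of_real (pi * b) * (z - of_real (real k * b)))) *
          exp (log_double_sine b (z - of_real (real n * b)))
      else
        let n = (LEAST n::nat. 0 < Re z + real n * b) in
          exp (log_double_sine b (z + of_real (real n * b))) /
          (\<Prod>k<n. 2 * sin (of_real (pi * b) * (z + of_real (real k * b)))))"

text \<open>The six parameters of the symbol are \<open>a 1, \<dots>, a 6\<close>.\<close>

definition sixj_t :: "(nat \<Rightarrow> complex) \<Rightarrow> nat \<Rightarrow> complex" where
  "sixj_t a i =
     [a 1 + a 2 + a 3, a 1 + a 5 + a 6, a 2 + a 4 + a 6, a 3 + a 4 + a 5] ! (i - 1)"

definition sixj_q :: "real \<Rightarrow> (nat \<Rightarrow> complex) \<Rightarrow> nat \<Rightarrow> complex" where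
  "sixj_q b a j =
     [a 1 + a 2 + a 4 + a 5, a 1 + a 3 + a 4 + a 6, a 2 + a 3 + a 5 + a 6,
      of_real (2 * Qb b)] ! (j - 1)"

text \<open>The line of integration is \<open>Re u = 7 Q / 4\<close>, the midpoint of the admissible interval
  \<open>(3 Q / 2, 2 Q)\<close>; the value does not depend on the choice of the line.\<close>

definition b6j :: "real \<Rightarrow> (nat \<Rightarrow> complex) \<Rightarrow> complex" where
  "b6j b a =
     exp (- (1/2) * (\<Sum>i=1..4. \<Sum>j=1..4. log_double_sine b (sixj_q b a j - sixj_t a i))) *
     (LINT y|lborel.
        (let u = Complex (7/4 * Qb b) y in
           (\<Prod>i=1..4. double_sine b (u - sixj_t a i)) *
           (\<Prod>j=1..4. double_sine b (sixj_q b a j - u))))"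


section \<open>Hyperbolic 3-manifolds with totally geodesic boundary\<close>

text \<open>Distance of hyperbolic 3-space in the upper half-space model \<open>x $ 3 > 0\<close>.\<close>

definition hyp_dist :: "real^3 \<Rightarrow> real^3 \<Rightarrow> real" where
  "hyp_dist x y = arcosh (1 + (dist x y)\<^sup>2 / (2 * x $ 3 * y $ 3))"

text \<open>A closed half-space of hyperbolic 3-space, bounded by the totally geodesic plane
  \<open>x $ 1 = 0\<close>.\<close>

definition hyp_half_space :: "(real^3) set" where
  "hyp_half_space = {x. 0 < x $ 3 \<and> 0 \<le> x $ 1}"

text \<open>Isometric charts of \<open>(M, d)\<close> with values in the half-space. The hyperbolic and the Euclidean
  topology agree on the model, so openness of the image is the Euclidean one.\<close>

definition hyp_chart :: "'m set \<Rightarrow> ('m \<Rightarrow> 'm \<Rightarrow> real) \<Rightarrow> 'm set \<Rightarrow> ('m \<Rightarrow> real^3) \<Rightarrow> bool" where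
  "hyp_chart M d U f \<longleftrightarrow>
     openin (Metric_space.mtopology M d) U \<and>
     openin (top_of_set hyp_half_space) (f ` U) \<and>
     (\<forall>x\<in>U. \<forall>y\<in>U. hyp_dist (f x) (f y) = d x y)"

text \<open>A hyperbolic metric with totally geodesic boundary is encoded by a distance function that is
  locally isometric to the half-space. The distance of the Riemannian metric has this property
  (with a large constant between different components). The manifold may be disconnected and
  non-orientable.\<close>

definition hyperbolic_3mfd_geodesic_boundary :: "'m set \<Rightarrow> ('m \<Rightarrow> 'm \<Rightarrow> real) \<Rightarrow> bool" where
  "hyperbolic_3mfd_geodesic_boundary M d \<longleftrightarrow>
     Metric_space M d \<and>
     compact_space (Metric_space.mtopology M d) \<and>
     (\<forall>x\<in>M. \<exists>U f. x \<in> U \<and> hyp_chart M d U f) \<and>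
     (\<exists>x\<in>M. \<exists>U f. x \<in> U \<and> hyp_chart M d U f \<and> f x $ 1 = 0)"


section \<open>Ideal triangulations\<close>

text \<open>The standard truncated tetrahedron in barycentric coordinates: its vertices before truncation
  are indexed by the type \<open>4\<close>, and the triangle of truncation at \<open>i\<close> is \<open>x $ i = 2/3\<close>.
  The face with index \<open>i\<close> is the hexagon opposite to the vertex \<open>i\<close>; edges are indexed by
  their two-element sets of end vertices.\<close>

definition trunc_tet :: "(real^4) set" where
  "trunc_tet = {x. (\<forall>i. 0 \<le> x $ i \<and> x $ i \<le> 2/3) \<and> (\<Sum>i\<in>UNIV. x $ i) = 1}"

definition tet_face :: "4 \<Rightarrow> (real^4) set" where
  "tet_face i = {x\<in>trunc_tet. x $ i = 0}"

definition tet_edge :: "4 set \<Rightarrow> (real^4) set" where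
  "tet_edge A = {x\<in>trunc_tet. \<forall>k. k \<notin> A \<longrightarrow> x $ k = 0}"

definition edge_labels :: "4 set set" where
  "edge_labels = {A. card A = 2}"

text \<open>\<open>g\<close> pairs the faces of the tetrahedra of \<open>T\<close>, and \<open>\<phi> F\<close> is the homeomorphism from the
  face \<open>F\<close> to the face \<open>g F\<close>. As a homeomorphism of truncated faces it takes the edges of the
  tetrahedra to edges (equivalently, the sides of truncation to sides of truncation).\<close>

definition face_gluing ::
    "'t set \<Rightarrow> ('t \<times> 4 \<Rightarrow> 't \<times> 4) \<Rightarrow> ('t \<times> 4 \<Rightarrow> real^4 \<Rightarrow> real^4) \<Rightarrow> bool" where
  "face_gluing T g \<phi> \<longleftrightarrow>
     (\<forall>F\<in>T \<times> UNIV. g F \<in> T \<times> UNIV \<and> g F \<noteq> F \<and> g (g F) = F) \<and>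
     (\<forall>F\<in>T \<times> UNIV.
        homeomorphism (tet_face (snd F)) (tet_face (snd (g F))) (\<phi> F) (\<phi> (g F)) \<and>
        (\<forall>A\<in>edge_labels. snd F \<notin> A \<longrightarrow>
           (\<exists>B\<in>edge_labels. snd (g F) \<notin> B \<and> \<phi> F ` tet_edge A = tet_edge B)))"

definition glue_rel ::
    "'t set \<Rightarrow> ('t \<times> 4 \<Rightarrow> 't \<times> 4) \<Rightarrow> ('t \<times> 4 \<Rightarrow> real^4 \<Rightarrow> real^4) \<Rightarrow>
     (('t \<times> (real^4)) \<times> ('t \<times> (real^4))) set" where
  "glue_rel T g \<phi> =
     {((\<Delta>, x), (fst (g (\<Delta>, i)), \<phi> (\<Delta>, i) x)) | \<Delta> i x. \<Delta> \<in> T \<and> x \<in> tet_face i}"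

text \<open>The realization of the space \<open>X\<close> as the quotient of the disjoint union of the tetrahedra is
  given by the quotient map \<open>p\<close>, whose fibres are the classes of the equivalence relation
  generated by the gluing.\<close>

definition ideal_triangulation ::
    "'m topology \<Rightarrow> 't set \<Rightarrow> ('t \<times> 4 \<Rightarrow> 't \<times> 4) \<Rightarrow> ('t \<times> 4 \<Rightarrow> real^4 \<Rightarrow> real^4) \<Rightarrow>
     ('t \<times> (real^4) \<Rightarrow> 'm) \<Rightarrow> bool" where
  "ideal_triangulation X T g \<phi> p \<longleftrightarrow>
     finite T \<and> face_gluing T g \<phi> \<and>
     quotient_map (prod_topology (discrete_topology T) (top_of_set trunc_tet)) X p \<and>
     (\<forall>v\<in>T \<times> trunc_tet. \<forall>w\<in>T \<times> trunc_tet.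
        p v = p w \<longleftrightarrow> (v, w) \<in> (glue_rel T g \<phi> \<union> (glue_rel T g \<phi>)\<inverse>)\<^sup>*)"

text \<open>An edge of the triangulation is the image in the manifold of an edge of a tetrahedron; a corner
  is an edge of an individual tetrahedron.\<close>

definition corners :: "'t set \<Rightarrow> ('t \<times> 4 set) set" where
  "corners T = T \<times> edge_labels"

definition edge_at :: "('t \<times> (real^4) \<Rightarrow> 'm) \<Rightarrow> 't \<times> 4 set \<Rightarrow> 'm set" where
  "edge_at p c = p ` ({fst c} \<times> tet_edge (snd c))"

definition tri_edges :: "'t set \<Rightarrow> ('t \<times> (real^4) \<Rightarrow> 'm) \<Rightarrow> 'm set set" where
  "tri_edges T p = edge_at p ` corners T"

definition angle_structure ::
    "'t set \<Rightarrow> ('t \<times> (real^4) \<Rightarrow> 'm) \<Rightarrow> ('t \<times> 4 set \<Rightarrow> real) \<Rightarrow> bool" where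
  "angle_structure T p \<alpha> \<longleftrightarrow>
     (\<forall>c\<in>corners T. 0 < \<alpha> c \<and> \<alpha> c < pi) \<and>
     (\<forall>\<Delta>\<in>T. \<forall>v. (\<Sum>A | A \<in> edge_labels \<and> v \<in> A. \<alpha> (\<Delta>, A)) < pi) \<and>
     (\<forall>e\<in>tri_edges T p. (\<Sum>c | c \<in> corners T \<and> edge_at p c = e. \<alpha> c) = 2 * pi)"


section \<open>The state integral\<close>

text \<open>A colouring with values in \<open>Q/2 + \<i> (0,\<infinity>)\<close> is parametrized by the imaginary parts \<open>y\<close>
  of its values.\<close>

definition colour :: "real \<Rightarrow> ('e \<Rightarrow> real) \<Rightarrow> 'e \<Rightarrow> complex" where
  "colour b y e = Complex (Qb b / 2) (y e)"

definition edge_weight :: "real \<Rightarrow> complex \<Rightarrow> real" where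
  "edge_weight b a = (cmod (double_sine b (2 * a)))\<^sup>2"

text \<open>The edges with numbers 1, 2, 3 form the face with vertices 0, 1, 2, and the edges \<open>k\<close> and
  \<open>k + 3\<close> are opposite. By the symmetries of the symbol any other such numbering gives the same
  weight.\<close>

definition tet_label :: "nat \<Rightarrow> 4 set" where
  "tet_label k = [{0, 1}, {1, 2}, {0, 2}, {2, 3}, {0, 3}, {1, 3}] ! (k - 1)"

definition tet_weight ::
    "real \<Rightarrow> ('t \<times> (real^4) \<Rightarrow> 'm) \<Rightarrow> ('m set \<Rightarrow> complex) \<Rightarrow> 't \<Rightarrow> complex" where
  "tet_weight b p a \<Delta> = b6j b (\<lambda>k. a (edge_at p (\<Delta>, tet_label k)))"

definition state_integrand ::
    "real \<Rightarrow> 't set \<Rightarrow> ('t \<times> (real^4) \<Rightarrow> 'm) \<Rightarrow> ('m set \<Rightarrow> real) \<Rightarrow> complex" where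
  "state_integrand b T p y =
     of_real (\<Prod>e\<in>tri_edges T p. edge_weight b (colour b y e)) *
     (\<Prod>\<Delta>\<in>T. tet_weight b p (colour b y) \<Delta>)"

end

theory Submission
  imports Defs
begin

text \<open>Splitting the numerator of the kernel into two exponentials and moving one of them to the lower
  half circle, at the cost of the residue at the origin, gives
  \<open>log \<bar>S\<^sub>b(x + \<i>y)\<bar> = - \<pi> (Q/2 - x) \<bar>y\<bar> + O(1)\<close>, uniformly on closed substrips of \<open>0 < x < Q\<close>.
  So an edge weight is at most a constant times \<open>exp (2 \<pi> Q y)\<close>. The line \<open>Re u = 7Q/4\<close> bounds the
  symbol by \<open>exp (- \<pi> Q \<tau> / 2)\<close>, where \<open>\<tau>\<close> is the sum of the imaginary parts around any face, and
  moving the line towards \<open>Re u = 2Q\<close> bounds it by \<open>exp (- \<pi> Q p)\<close>, up to an arbitrarily small loss in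
  the rate, where \<open>p\<close> is the sum over any pair of opposite edges. The largest \<open>p\<close> or \<open>\<tau> / 2\<close>, times
  \<open>\<pi>\<close>, is exactly the maximum of \<open>\<Sum> \<alpha> y\<close> over the dihedral angles with vertex sums at most \<open>\<pi>\<close>.
  Since the angles around every edge add up to \<open>2 \<pi>\<close> and the vertex sums of an angle structure are
  strictly below \<open>\<pi>\<close>, the integrand decays exponentially in every variable.\<close>

section \<open>Growth of the double sine function\<close>

text \<open>For large \<open>Im z\<close>, either half circle makes one of the two exponentials in
  the numerator blow up, so the integral as it stands hides its true rate. Once each exponential
  runs along the half circle on which it stays bounded, the residue alone carries the growth.
  Writing \<open>2 \<pi>\<close> as the sum of the angles around an edge hands the growth of its
  weight out to the corners. The claim thereby becomes local: the symbol of each tetrahedron has to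
  beat \<open>exp (Q \<Sum> \<alpha> y)\<close>. No single line of integration gives both decay
  rates by these estimates. The line \<open>7Q/4\<close> gives equal weight to the distances from
  all eight points \<open>t_i\<close>, \<open>q_j\<close> and detects faces; opposite edges need
  nearly full weight on the distances from the \<open>q_j\<close>, hence a line near
  \<open>2Q\<close>. The line \<open>2Q\<close> itself meets poles of the integrand at the
  \<open>q_j\<close>, and part of the decay must be kept to integrate along the line, so some of the
  rate is lost. There are finitely many vertex sums, all below \<open>\<pi>\<close>, and the uniform
  gap pays for this loss.\<close>

definition sinhc :: "complex \<Rightarrow> complex" where
  "sinhc x = (if x = 0 then 1 else sinh x / x)"

lemma holomorphic_sinhc: "sinhc holomorphic_on UNIV"
proof -
  have "(\<lambda>z. if z = 0 then deriv sinh 0 else (sinh z - sinh 0) / (z - 0 :: complex)) holomorphic_on UNIV"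
    by (rule pole_lemma) (auto simp: sinh_def [abs_def] intro!: holomorphic_intros)
  moreover have "deriv sinh (0::complex) = 1"
    by (rule DERIV_imp_deriv) (auto intro!: derivative_eq_intros)
  ultimately show ?thesis
    by (simp add: sinhc_def [abs_def] cong: if_cong)
qed

lemma sinhc_nonzero:
  assumes "cmod x < pi" shows "sinhc x \<noteq> 0"
proof
  assume *: "sinhc x = 0"
  then have "x \<noteq> 0" "sin (\<i> * x) = 0"
    by (auto simp: sinhc_def sinh_conv_sin split: if_splits)
  then obtain n :: int where n: "\<i> * x = of_real (real_of_int n * pi)"
    by (auto simp: sin_eq_0)
  then have "cmod x = \<bar>real_of_int n\<bar> * pi"
    by (metis mult_1 norm_ii norm_mult norm_of_real abs_mult abs_of_pos pi_gt_zero)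
  with assms have "\<bar>real_of_int n\<bar> * pi < 1 * pi" by simp
  then have "\<bar>real_of_int n\<bar> < 1" by (simp only: mult_less_cancel_right_pos pi_gt_zero)
  then have "n = 0" by linarith
  with n \<open>x \<noteq> 0\<close> show False by simp
qed

lemma sinhc_minus: "sinhc (- x) = sinhc x"
  by (simp add: sinhc_def)

text \<open>As \<open>(b t / 2) (t / (2 b)) = t ^ 2 / 4\<close>, the denominator
  \<open>4 t sinh (b t / 2) sinh (t / (2 b))\<close> of the kernel is
  \<open>t ^ 3 / dsine_reg b t\<close>. The factor \<open>1 / t ^ 3\<close> is split off, and what
  remains is regular at the origin.\<close>

definition dsine_reg :: "real \<Rightarrow> complex \<Rightarrow> complex" where
  "dsine_reg b t = 1 / (sinhc (of_real b * t / 2) * sinhc (t / (2 * of_real b)))"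

lemma dsine_reg_0: "dsine_reg b 0 = 1"
  by (simp add: dsine_reg_def sinhc_def)

lemma dsine_reg_minus: "dsine_reg b (- t) = dsine_reg b t"
  by (simp add: dsine_reg_def sinhc_minus)

lemma dsine_kernel_eq:
  assumes "b \<noteq> 0" "t \<noteq> 0"
  shows "dsine_kernel b z t =
    (exp ((of_real (Qb b) / 2 - z) * t) - exp (- ((of_real (Qb b) / 2 - z) * t))) / 2 * (dsine_reg b t / t ^ 3)"
proof -
  have "sinh ((of_real (Qb b) / 2 - z) * t) =
    (exp ((of_real (Qb b) / 2 - z) * t) - exp (- ((of_real (Qb b) / 2 - z) * t))) / 2"
    by (rule sinh_field_def)
  moreover have "dsine_reg b t / t ^ 3 = 1 / (4 * t * sinh (of_real b * t / 2) * sinh (t / (2 * of_real b)))"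
    using assms by (simp add: dsine_reg_def sinhc_def power3_eq_cube)
  ultimately show ?thesis by (simp only: dsine_kernel_def) simp
qed

lemma dsine_kernel_minus: "dsine_kernel b z (- t) = dsine_kernel b z t"
  by (simp add: dsine_kernel_def)

lemma dsine_kernel_reflect: "dsine_kernel b (of_real (Qb b) - z) t = - dsine_kernel b z t"
proof -
  have "of_real (Qb b) / 2 - (of_real (Qb b) - z) = - (of_real (Qb b) / 2 - z)" by simp
  then show ?thesis unfolding dsine_kernel_def by (simp only: mult_minus_left sinh_minus minus_divide_left)
qed

text \<open>The kernel is odd under reflection of \<open>z\<close> in \<open>Q/2\<close>, pointwise
  on a contour that does not depend on \<open>z\<close>.\<close>

lemma log_double_sine_reflect: "log_double_sine b (of_real (Qb b) - z) = - log_double_sine b z"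
  by (simp add: log_double_sine_def dsine_kernel_reflect [abs_def] contour_integral_neg
      set_lebesgue_integral_def)

text \<open>The zeros of the two denominators closest to the origin have modulus
  \<open>2 \<pi> b\<close> and \<open>2 \<pi> / b\<close>; for \<open>b < 1\<close> the first is the
  smaller one.\<close>

lemma holomorphic_dsine_reg:
  assumes "0 < b" "b < 1"
  shows "dsine_reg b holomorphic_on ball 0 (2 * pi * b)"
proof -
  have 1: "(\<lambda>t. sinhc (of_real b * t / 2)) holomorphic_on ball 0 (2 * pi * b)"
    "(\<lambda>t. sinhc (t / (2 * of_real b))) holomorphic_on ball 0 (2 * pi * b)"
    by (rule holomorphic_on_compose_gen[OF _ holomorphic_sinhc, unfolded o_def];
        use assms in \<open>auto intro!: holomorphic_intros\<close>)+
  have "sinhc (of_real b * t / 2) \<noteq> 0" "sinhc (t / (2 * of_real b)) \<noteq> 0"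
    if "t \<in> ball 0 (2 * pi * b)" for t
  proof -
    have t: "cmod t < 2 * pi * b" using that by simp
    have "b * cmod t \<le> 1 * cmod t" using assms by (intro mult_right_mono) auto
    also have "\<dots> < 2 * pi * b" using t by simp
    also have "\<dots> \<le> 2 * pi * 1" using assms by (intro mult_left_mono) auto
    finally have "cmod (of_real b * t / 2) < pi" using assms by (simp add: norm_mult)
    moreover have "cmod (t / (2 * of_real b)) < pi"
      using t assms by (simp add: norm_mult norm_divide field_simps)
    ultimately show "sinhc (of_real b * t / 2) \<noteq> 0" "sinhc (t / (2 * of_real b)) \<noteq> 0"
      by (simp_all only: sinhc_nonzero not_False_eq_True)
  qed
  with 1 show ?thesis unfolding dsine_reg_def [abs_def]
    by (intro holomorphic_intros) auto
qed

text \<open>An even function has derivative zero at the origin. This removes the term linear in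
  \<open>w\<close> from the residue below.\<close>

lemma deriv_dsine_reg_0:
  assumes "0 < b" "b < 1"
  shows "deriv (dsine_reg b) 0 = 0"
proof -
  have "dsine_reg b field_differentiable at 0"
    using holomorphic_dsine_reg[OF assms] assms
    by (intro holomorphic_on_imp_differentiable_at[of _ "ball 0 (2 * pi * b)"]) auto
  then have D: "(dsine_reg b has_field_derivative deriv (dsine_reg b) 0) (at (- 0))"
    by (simp add: field_differentiable_derivI)
  have "((\<lambda>t. dsine_reg b (- t)) has_field_derivative deriv (dsine_reg b) 0 * (- 1)) (at 0)"
    by (rule DERIV_chain'[where f = uminus and g = "dsine_reg b", OF _ D]) (auto intro!: derivative_eq_intros)
  with D have "deriv (dsine_reg b) 0 * (- 1) = deriv (dsine_reg b) 0"
    by (intro DERIV_unique[of "dsine_reg b"]) (simp_all add: dsine_reg_minus)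
  then show ?thesis by simp
qed

lemma higher_deriv_exp_linear: "(deriv ^^ n) (\<lambda>t. exp (w * t)) = (\<lambda>t. w ^ n * exp (w * t :: complex))"
proof (induction n)
  case (Suc n)
  have "deriv (\<lambda>t. w ^ n * exp (w * t)) t = w ^ Suc n * exp (w * t)" for t
    by (rule DERIV_imp_deriv) (auto intro!: derivative_eq_intros)
  with Suc show ?case by auto
qed simp

text \<open>Cauchy's formula for the second derivative at a triple pole, combined with the Leibniz
  rule. The term \<open>w\<^sup>2\<close> is the source of the asymptotics of the double sine
  function.\<close>

lemma contour_integral_circlepath_exp_dsine_reg:
  assumes "0 < b" "b < 1"
  shows "contour_integral (circlepath 0 (pi * b)) (\<lambda>t. exp (w * t) * dsine_reg b t / t ^ 3) =
           pi * \<i> * (w\<^sup>2 + (deriv ^^ 2) (dsine_reg b) 0)"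
proof -
  let ?f = "\<lambda>t. exp (w * t) * dsine_reg b t"
  have G: "dsine_reg b holomorphic_on ball 0 (2 * pi * b)" by (rule holomorphic_dsine_reg[OF assms])
  then have f: "?f holomorphic_on ball 0 (2 * pi * b)"
    by (intro holomorphic_intros)
  have sub: "cball 0 (pi * b) \<subseteq> ball (0::complex) (2 * pi * b)"
  proof
    fix x :: complex assume "x \<in> cball 0 (pi * b)"
    moreover have "pi * b < 2 * pi * b" using assms by simp
    ultimately show "x \<in> ball 0 (2 * pi * b)" by (simp only: mem_ball_0 mem_cball_0)
  qed
  have "((\<lambda>u. ?f u / (u - 0) ^ Suc 2) has_contour_integral ((2 * pi * \<i>) / (fact 2) * (deriv ^^ 2) ?f 0))
           (circlepath 0 (pi * b))"
    by (rule Cauchy_has_contour_integral_higher_derivative_circlepath)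
      (use assms f sub order_trans[OF ball_subset_cball sub] in
        \<open>auto intro: holomorphic_on_subset holomorphic_on_imp_continuous_on\<close>)
  moreover have "(deriv ^^ 2) ?f 0 = (\<Sum>i = 0..2. of_nat (2 choose i) *
      (deriv ^^ i) (\<lambda>t. exp (w * t)) 0 * (deriv ^^ (2 - i)) (dsine_reg b) 0)"
    by (rule higher_deriv_mult[OF _ G]) (use assms in \<open>auto intro!: holomorphic_intros\<close>)
  moreover have "\<dots> = w\<^sup>2 + (deriv ^^ 2) (dsine_reg b) 0"
    by (simp add: higher_deriv_exp_linear numeral_2_eq_2 deriv_dsine_reg_0[OF assms] dsine_reg_0)
  ultimately have "((\<lambda>u. ?f u / u ^ 3) has_contour_integral
      (pi * \<i> * (w\<^sup>2 + (deriv ^^ 2) (dsine_reg b) 0))) (circlepath 0 (pi * b))"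
    by (simp add: numeral_3_eq_3)
  then show ?thesis by (rule contour_integral_unique)
qed

section \<open>Upper and lower half circles\<close>

text \<open>Both arcs lead from \<open>c - r\<close> to \<open>c + r\<close>, the upper one
  clockwise and the lower one counterclockwise, so they differ by one full turn.\<close>

lemma contour_integral_upper_lower_circlepath:
  assumes "continuous_on (sphere c r) f" "0 \<le> r"
  shows "contour_integral (part_circlepath c r pi 0) f =
    contour_integral (part_circlepath c r pi (2 * pi)) f - contour_integral (circlepath c r) f"
proof -
  have "continuous_on {0..2*pi} (\<lambda>t. f (c + r * cis t) * r * \<i> * cis t)"
    by (intro continuous_intros continuous_on_compose2[OF assms(1)])
      (use assms(2) in \<open>auto simp: dist_norm norm_mult\<close>)
  then have "integral {0..pi} (\<lambda>t. f (c + r * cis t) * r * \<i> * cis t)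
     + integral {pi..2*pi} (\<lambda>t. f (c + r * cis t) * r * \<i> * cis t)
     = integral {0..2*pi} (\<lambda>t. f (c + r * cis t) * r * \<i> * cis t)"
    by (intro Henstock_Kurzweil_Integration.integral_combine integrable_continuous_interval) auto
  then show ?thesis
    by (subst contour_integral_part_circlepath_reverse)
      (simp add: circlepath_def contour_integral_part_circlepath_eq eq_diff_eq, simp add: algebra_simps)
qed

lemma path_image_part_circlepath_sphere:
  assumes "0 \<le> r" shows "path_image (part_circlepath c r s t) \<subseteq> sphere c r"
  using assms by (auto simp: path_image_def part_circlepath_def dist_norm norm_mult)

lemma Im_part_circlepath_upper:
  assumes "t \<in> path_image (part_circlepath 0 r pi 0)" "0 \<le> r" shows "0 \<le> Im t"
proof -
  have "t \<in> path_image (part_circlepath 0 r 0 pi)"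
    using assms(1) by (metis path_image_reversepath reversepath_part_circlepath)
  then show ?thesis using assms(2)
    by (auto simp: path_image_part_circlepath Im_exp sin_ge_zero)
qed

lemma Im_part_circlepath_lower:
  assumes "t \<in> path_image (part_circlepath 0 r pi (2 * pi))" "0 \<le> r" shows "Im t \<le> 0"
proof -
  from assms obtain x where x: "t = r * exp (\<i> * of_real x)" "pi \<le> x" "x \<le> 2 * pi"
    by (auto simp: path_image_part_circlepath)
  have "sin x \<le> 0"
    using x sin_ge_zero[of "x - pi"] by simp
  with x assms show ?thesis by (simp add: Im_exp mult_nonneg_nonpos)
qed

section \<open>Decay of the kernel on the real line and asymptotics of the logarithm\<close>

lemma exp_minus_set_integral:
  assumes "0 < a"
  shows "set_integrable lborel {c..} (\<lambda>x::real. exp (- a * x))"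
    and "(LINT x:{c..}|lborel. exp (- a * x)) = exp (- a * c) / a"
proof -
  have "(\<lambda>x. exp (- a * x)) absolutely_integrable_on {c..}"
    using integrable_on_exp_minus_to_infinity[OF assms] by (intro nonnegative_absolutely_integrable_1) auto
  then show *: "set_integrable lborel {c..} (\<lambda>x::real. exp (- a * x))"
    unfolding set_integrable_def by (subst (asm) integrable_completion) auto
  show "(LINT x:{c..}|lborel. exp (- a * x)) = exp (- a * c) / a"
    using set_borel_integral_eq_integral(2)[OF *] has_integral_exp_minus_to_infinity[OF assms, of c]
    by (simp add: integral_unique)
qed

lemma norm_sinh_le: "cmod (sinh z) \<le> exp \<bar>Re z\<bar>"
proof -
  have "cmod (sinh z) \<le> (cmod (exp z) + cmod (exp (- z))) / 2"
    using norm_triangle_ineq4[of "exp z" "exp (- z)"] by (simp only: sinh_field_def norm_divide) simp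
  also have "\<dots> \<le> (exp \<bar>Re z\<bar> + exp \<bar>Re z\<bar>) / 2"
    by (intro divide_right_mono add_mono) auto
  also have "\<dots> = exp \<bar>Re z\<bar>" by simp
  finally show ?thesis .
qed

lemma sinh_complex_of_real: "sinh (complex_of_real x) = of_real (sinh x)"
  by (simp add: sinh_field_def exp_of_real flip: of_real_minus)

lemma sinh_real_ge_exp:
  assumes "0 < c" "c \<le> x"
  shows "(1 - exp (- 2 * c)) / 2 * exp x \<le> sinh (x::real)"
proof -
  have "exp (- 2 * c) * exp x \<ge> exp (- 2 * x) * exp x"
    using assms by simp
  moreover have "exp (- 2 * x) * exp x = exp (- x)"
    by (simp flip: exp_add)
  ultimately have "(1 - exp (- 2 * c)) * exp x \<le> exp x - exp (- x)"
    by (simp only: left_diff_distrib mult_1)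
  then show ?thesis by (simp add: sinh_field_def)
qed

lemma Qb_pos: "0 < b \<Longrightarrow> 0 < Qb b"
  by (simp add: Qb_def add_pos_pos)

text \<open>The numerator grows at the rate \<open>\<bar>Q/2 - Re z\<bar>\<close>, the two
  hyperbolic sines in the denominator together at the rate
  \<open>b/2 + 1/(2b) = Q/2\<close>.\<close>

lemma dsine_kernel_bound:
  assumes "0 < b"
  shows "\<exists>C\<ge>0. \<forall>z. \<forall>t\<ge>pi * b. cmod (dsine_kernel b z (of_real t)) \<le>
    C * exp (- (Qb b / 2 - \<bar>Qb b / 2 - Re z\<bar>) * t)"
proof -
  \<comment> \<open>The constants of \<open>sinh_real_ge_exp\<close> for the smallest values of
    \<open>b t / 2\<close> and \<open>t / (2 b)\<close>, those at
    \<open>t = \<pi> b\<close>.\<close>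
  let ?c1 = "(1 - exp (- 2 * (b * (pi * b) / 2))) / 2" and ?c2 = "(1 - exp (- 2 * (pi * b / (2 * b)))) / 2"
  let ?C = "1 / (4 * (pi * b) * ?c1 * ?c2)"
  have c: "0 < ?c1" "0 < ?c2" using assms by auto
  have C: "0 \<le> ?C" using c assms by (intro divide_nonneg_nonneg mult_nonneg_nonneg) auto
  have "cmod (dsine_kernel b z (of_real t)) \<le> ?C * exp (- (Qb b / 2 - \<bar>Qb b / 2 - Re z\<bar>) * t)"
    if t: "pi * b \<le> t" for z t
  proof -
    have t0: "0 < t" using t assms by (smt (verit) mult_pos_pos pi_gt_zero)
    have s1: "?c1 * exp (b * t / 2) \<le> sinh (b * t / 2)"
      by (rule sinh_real_ge_exp) (use assms t in \<open>auto intro!: mult_left_mono\<close>)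
    have s2: "?c2 * exp (t / (2 * b)) \<le> sinh (t / (2 * b))"
      by (rule sinh_real_ge_exp) (use assms t in \<open>auto simp: field_simps\<close>)
    have "of_real b * of_real t / 2 = complex_of_real (b * t / 2)"
      "complex_of_real t / (2 * of_real b) = complex_of_real (t / (2 * b))" by auto
    then have den: "cmod (4 * of_real t * sinh (of_real b * of_real t / 2) * sinh (of_real t / (2 * of_real b)))
      = 4 * t * sinh (b * t / 2) * sinh (t / (2 * b))"
      using t0 assms by (simp only: sinh_complex_of_real norm_mult norm_of_real) (simp add: sinh_real_nonneg_iff)
    have den_le: "(4 * (pi * b)) * (?c1 * exp (b * t / 2)) * (?c2 * exp (t / (2 * b)))
        \<le> 4 * t * sinh (b * t / 2) * sinh (t / (2 * b))"
      using s1 s2 t t0 c assms by (intro mult_mono) auto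
    have den_pos: "0 < (4 * (pi * b)) * (?c1 * exp (b * t / 2)) * (?c2 * exp (t / (2 * b)))"
      using c assms by (intro mult_pos_pos) auto
    have "cmod (sinh ((of_real (Qb b) / 2 - z) * of_real t)) \<le> exp (\<bar>Qb b / 2 - Re z\<bar> * t)"
      using norm_sinh_le[of "(of_real (Qb b) / 2 - z) * of_real t"] t0 by (simp add: abs_mult)
    then have "cmod (dsine_kernel b z (of_real t)) \<le>
      exp (\<bar>Qb b / 2 - Re z\<bar> * t) / ((4 * (pi * b)) * (?c1 * exp (b * t / 2)) * (?c2 * exp (t / (2 * b))))"
      unfolding dsine_kernel_def norm_divide den
      using den_le den_pos by (intro frac_le) auto
    also have "\<dots> = ?C * (exp (\<bar>Qb b / 2 - Re z\<bar> * t) / (exp (b * t / 2) * exp (t / (2 * b))))"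
      by simp
    also have "exp (\<bar>Qb b / 2 - Re z\<bar> * t) / (exp (b * t / 2) * exp (t / (2 * b))) =
       exp (- (Qb b / 2 - \<bar>Qb b / 2 - Re z\<bar>) * t)"
      by (simp add: Qb_def field_simps flip: exp_add exp_diff)
    finally show ?thesis .
  qed
  with C show ?thesis by blast
qed

lemma dsine_kernel_measurable [measurable]: "dsine_kernel b z \<in> borel_measurable borel"
  unfolding dsine_kernel_def sinh_field_def by measurable

text \<open>On the substrip the rate \<open>Q/2 - \<bar>Q/2 - Re z\<bar>\<close> is at least
  \<open>\<delta>\<close>, so one constant serves all \<open>z\<close>. The case
  \<open>s = \<pi> b\<close> bounds the ray integral; large \<open>s\<close> gives the uniform
  convergence behind holomorphy.\<close>

lemma dsine_kernel_tail:
  assumes "0 < b" "0 < \<delta>"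
  shows "\<exists>C\<ge>0. \<forall>z s A. \<delta> \<le> Re z \<longrightarrow> Re z \<le> Qb b - \<delta> \<longrightarrow> pi * b \<le> s \<longrightarrow> A \<subseteq> {s..} \<longrightarrow> A \<in> sets borel \<longrightarrow>
    set_integrable lborel A (\<lambda>t. dsine_kernel b z (complex_of_real t)) \<and>
    cmod (LINT t:A|lborel. dsine_kernel b z (complex_of_real t)) \<le> C * exp (- \<delta> * s)"
proof -
  obtain C where C: "0 \<le> C" "\<And>z t. pi * b \<le> t \<Longrightarrow> cmod (dsine_kernel b z (of_real t)) \<le>
    C * exp (- (Qb b / 2 - \<bar>Qb b / 2 - Re z\<bar>) * t)"
    using dsine_kernel_bound[OF assms(1)] by metis
  have main: "set_integrable lborel A (\<lambda>t. dsine_kernel b z (complex_of_real t)) \<and>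
      cmod (LINT t:A|lborel. dsine_kernel b z (complex_of_real t)) \<le> C / \<delta> * exp (- \<delta> * s)"
    if z: "\<delta> \<le> Re z" "Re z \<le> Qb b - \<delta>" and s: "pi * b \<le> s" and A: "A \<subseteq> {s..}" "A \<in> sets borel" for z s A
  proof -
    let ?f = "\<lambda>t. indicator A t *\<^sub>R dsine_kernel b z (complex_of_real t)"
    let ?g = "\<lambda>t. C * (indicator {s..} t *\<^sub>R exp (- \<delta> * t))"
    have g: "integrable lborel ?g"
      using exp_minus_set_integral(1)[OF assms(2), of s] unfolding set_integrable_def
      by (rule integrable_mult_right)
    have le: "cmod (?f t) \<le> ?g t" for t
    proof (cases "t \<in> A")
      case True
      with A s have t: "s \<le> t" "pi * b \<le> t" by auto
      moreover have "0 \<le> t" using t assms by (smt (verit) mult_pos_pos pi_gt_zero)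
      moreover have "\<delta> \<le> Qb b / 2 - \<bar>Qb b / 2 - Re z\<bar>" using z by linarith
      ultimately have "exp (- (Qb b / 2 - \<bar>Qb b / 2 - Re z\<bar>) * t) \<le> exp (- \<delta> * t)"
        using mult_right_mono[of \<delta> "Qb b / 2 - \<bar>Qb b / 2 - Re z\<bar>" t]
        by (simp only: mult_minus_left exp_le_cancel_iff neg_le_iff_le)
      with C(2)[OF t(2), of z] C(1) show ?thesis using True t
        by (simp add: order_trans[OF _ mult_left_mono])
    qed (use C in auto)
    have f: "integrable lborel ?f"
    proof (rule Bochner_Integration.integrable_bound[OF g])
      show "AE t in lborel. cmod (?f t) \<le> norm (?g t)"
        using le by (intro always_eventually allI) (metis abs_ge_self order_trans real_norm_def)
    qed (use A in auto)
    have "cmod (integral\<^sup>L lborel ?f) \<le> integral\<^sup>L lborel ?g"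
      by (rule Bochner_Integration.integral_norm_bound_integral[OF f g le])
    also have "\<dots> = C / \<delta> * exp (- \<delta> * s)"
      using exp_minus_set_integral(2)[OF assms(2), of s] by (simp add: set_lebesgue_integral_def)
    finally show ?thesis using f by (simp add: set_integrable_def set_lebesgue_integral_def)
  qed
  show ?thesis by (rule exI[of _ "C / \<delta>"]) (use main C assms in auto)
qed

lemma log_double_sine_eq:
  "log_double_sine b z = 2 * (LINT t:{pi * b..}|lborel. dsine_kernel b z (complex_of_real t)) +
     contour_integral (part_circlepath 0 (pi * b) pi 0) (dsine_kernel b z)"
proof -
  have "(LINT t:{..- (pi * b)}|lborel. dsine_kernel b z (complex_of_real t)) =
     (LINT t:{pi * b..}|lborel. dsine_kernel b z (complex_of_real t))"
    by (subst set_integral_reflect) (simp add: dsine_kernel_minus atLeast_def)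
  then show ?thesis by (simp add: log_double_sine_def)
qed

text \<open>Put \<open>w = Q/2 - z\<close>. On the circle \<open>exp (w t)\<close> has modulus
  \<open>exp (Im z * Im t)\<close> times a bounded factor. For \<open>Im z \<ge> 0\<close> it is
  therefore controlled on the lower arc, and \<open>exp (- (w * t))\<close> on the upper one. The
  residue paid for moving the first exponential is quadratic in \<open>w\<close>, and the mixed term
  of \<open>w\<^sup>2\<close> grows linearly in \<open>Im z\<close>.\<close>

lemma Re_log_double_sine_asymp_upper:
  assumes "0 < b" "b < 1" "0 < \<delta>"
  shows "\<exists>C. \<forall>z. \<delta> \<le> Re z \<longrightarrow> Re z \<le> Qb b - \<delta> \<longrightarrow> 0 \<le> Im z \<longrightarrow>
    \<bar>Re (log_double_sine b z) + pi * (Qb b / 2 - Re z) * Im z\<bar> \<le> C"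
proof -
  let ?r = "pi * b"
  have r: "0 < ?r" using assms by simp
  have sph: "sphere 0 ?r \<subseteq> ball (0::complex) (2 * pi * b) - {0}"
    using r assms by auto
  let ?g = "\<lambda>t. dsine_reg b t / t ^ 3"
  have cont_g: "continuous_on (sphere 0 ?r) ?g"
    using holomorphic_on_imp_continuous_on[OF holomorphic_on_subset[OF holomorphic_dsine_reg[OF assms(1,2)], of "sphere 0 ?r"]] sph
    by (intro continuous_intros) auto
  then have "bounded (?g ` sphere 0 ?r)"
    by (intro compact_imp_bounded compact_continuous_image) auto
  then obtain M where M: "0 < M" "\<And>t. t \<in> sphere 0 ?r \<Longrightarrow> cmod (?g t) \<le> M"
    by (auto simp: bounded_pos)
  obtain C1 where C1: "0 \<le> C1" "\<And>z. \<delta> \<le> Re z \<Longrightarrow> Re z \<le> Qb b - \<delta> \<Longrightarrow>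
      cmod (LINT t:{?r..}|lborel. dsine_kernel b z (complex_of_real t)) \<le> C1"
  proof -
    obtain C where "C \<ge> 0" "\<And>z. \<delta> \<le> Re z \<Longrightarrow> Re z \<le> Qb b - \<delta> \<Longrightarrow>
      cmod (LINT t:{?r..}|lborel. dsine_kernel b z (complex_of_real t)) \<le> C * exp (- \<delta> * ?r)"
      using dsine_kernel_tail[OF assms(1,3)] by (metis order_refl atLeast_borel)
    then show ?thesis using that[of "C * exp (- \<delta> * ?r)"] by auto
  qed
  \<comment> \<open>The length \<open>\<pi> r\<close> of a half circle times a bound of the
    integrand; the exponent uses the crude estimate \<open>\<bar>Re w\<bar> \<le> Q\<close>.\<close>
  define C2 where "C2 = exp (Qb b * ?r) * M * ?r * pi"
  let ?c = "(deriv ^^ 2) (dsine_reg b) 0"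
  have main: "\<bar>Re (log_double_sine b z) + pi * (Qb b / 2 - Re z) * Im z\<bar> \<le> 2 * C1 + C2 + pi * \<bar>Im ?c\<bar>"
    if z: "\<delta> \<le> Re z" "Re z \<le> Qb b - \<delta>" "0 \<le> Im z" for z
  proof -
    define w where "w = of_real (Qb b) / 2 - z"
    have w: "Re w = Qb b / 2 - Re z" "Im w = - Im z" "\<bar>Re w\<bar> \<le> Qb b" using z assms(3) by (auto simp: w_def)
    let ?p = "\<lambda>t. exp (w * t) * ?g t" and ?m = "\<lambda>t. exp (- (w * t)) * ?g t"
    have cont: "continuous_on (sphere 0 ?r) ?p" "continuous_on (sphere 0 ?r) ?m"
      by (intro continuous_intros cont_g)+
    have ci: "?p contour_integrable_on part_circlepath 0 ?r s s'" "?m contour_integrable_on part_circlepath 0 ?r s s'" for s s'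
      by (intro contour_integrable_continuous_part_circlepath continuous_on_subset[OF _ path_image_part_circlepath_sphere] cont;
          use r in simp)+
    let ?U = "part_circlepath 0 ?r pi 0" and ?L = "part_circlepath 0 ?r pi (2 * pi)"
    have reb: "\<bar>Re w * Re t\<bar> \<le> Qb b * ?r" if "t \<in> sphere 0 ?r" for t
      using w that abs_Re_le_cmod[of t] r by (auto simp: abs_mult intro!: mult_mono)
    have pU: "path_image ?U \<subseteq> sphere 0 ?r" "path_image ?L \<subseteq> sphere 0 ?r"
      using r by (intro path_image_part_circlepath_sphere; simp)+
    have bm: "cmod (?m t) \<le> exp (Qb b * ?r) * M" if "t \<in> path_image ?U" for t
    proof -
      have t: "t \<in> sphere 0 ?r" "0 \<le> Im t" using that pU Im_part_circlepath_upper[OF that] r by auto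
      have "Re (- (w * t)) \<le> Qb b * ?r" 
        using reb[OF t(1)] mult_nonneg_nonneg[OF t(2) z(3)] by (simp add: w(2) mult.commute abs_le_iff)
      then show ?thesis using M(2)[OF t(1)] by (simp only: norm_mult norm_exp_eq_Re) (intro mult_mono, auto)
    qed
    have bp: "cmod (?p t) \<le> exp (Qb b * ?r) * M" if "t \<in> path_image ?L" for t
    proof -
      have t: "t \<in> sphere 0 ?r" "Im t \<le> 0" using that pU Im_part_circlepath_lower[OF that] r by auto
      have "Re (w * t) \<le> Qb b * ?r" 
        using reb[OF t(1)] mult_nonpos_nonneg[OF t(2) z(3)] by (simp add: w(2) mult.commute abs_le_iff)
      then show ?thesis using M(2)[OF t(1)] by (simp only: norm_mult norm_exp_eq_Re) (intro mult_mono, auto)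
    qed
    have Um: "cmod (contour_integral ?U ?m) \<le> C2"
      using contour_integral_bound_part_circlepath[OF ci(2), of "exp (Qb b * ?r) * M" pi 0] bm M r by (simp add: C2_def)
    have Lp: "cmod (contour_integral ?L ?p) \<le> C2"
      using contour_integral_bound_part_circlepath[OF ci(1), of "exp (Qb b * ?r) * M" pi "2 * pi"] bp M r by (simp add: C2_def)
    have "contour_integral ?U (dsine_kernel b z) = contour_integral ?U (\<lambda>t. 1/2 * ?p t - 1/2 * ?m t)"
    proof (rule contour_integral_cong [OF refl])
      fix t assume "t \<in> path_image ?U"
      then have "t \<noteq> 0" using pU r by auto
      then show "dsine_kernel b z t = 1/2 * ?p t - 1/2 * ?m t"
        using assms by (simp add: dsine_kernel_eq w_def[symmetric] diff_divide_distrib left_diff_distrib)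
    qed
    also have "\<dots> = 1/2 * contour_integral ?U ?p - 1/2 * contour_integral ?U ?m"
      by (subst contour_integral_diff) (intro contour_integrable_lmul ci | subst contour_integral_lmul | rule refl)+
    also have "contour_integral ?U ?p = contour_integral ?L ?p - pi * \<i> * (w\<^sup>2 + ?c)"
      using contour_integral_upper_lower_circlepath[OF cont(1)] r
        contour_integral_circlepath_exp_dsine_reg[OF assms(1,2), of w] by simp
    finally have arc: "contour_integral ?U (dsine_kernel b z) = 1/2 * (contour_integral ?L ?p - pi * \<i> * (w\<^sup>2 + ?c)) -
      1/2 * contour_integral ?U ?m" .
    have "log_double_sine b z = 2 * (LINT t:{?r..}|lborel. dsine_kernel b z (complex_of_real t)) +
       (1/2 * contour_integral ?L ?p - 1/2 * contour_integral ?U ?m) - pi * \<i> * (w\<^sup>2 + ?c) / 2"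
      unfolding log_double_sine_eq arc by (simp add: diff_divide_distrib)
    \<comment> \<open>The real part of \<open>\<i> \<pi> w\<^sup>2 / 2\<close> is
      \<open>- \<pi> Re w Im w\<close>, and \<open>Im w = - Im z\<close>: this is the main
      term.\<close>
    moreover have "Re (pi * \<i> * (w\<^sup>2 + ?c) / 2) = pi * (Qb b / 2 - Re z) * Im z - pi * Im ?c / 2"
      by (simp add: power2_eq_square w(1,2)) (simp add: field_simps)
    ultimately have eq: "Re (log_double_sine b z) + pi * (Qb b / 2 - Re z) * Im z =
       2 * Re (LINT t:{?r..}|lborel. dsine_kernel b z (complex_of_real t)) +
       (Re (contour_integral ?L ?p) / 2 - Re (contour_integral ?U ?m) / 2) + pi * Im ?c / 2"
      by simp
    have "\<bar>2 * J + (L / 2 - U / 2) + c\<bar> \<le> 2 * C1 + C2 + c'"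
      if "\<bar>J\<bar> \<le> C1" "\<bar>L\<bar> \<le> C2" "\<bar>U\<bar> \<le> C2" "\<bar>c\<bar> \<le> c'" for J L U c c' :: real
      using that by linarith
    moreover have "\<bar>Re (LINT t:{?r..}|lborel. dsine_kernel b z (complex_of_real t))\<bar> \<le> C1"
      using C1(2)[OF z(1,2)] abs_Re_le_cmod order_trans by blast
    moreover have "\<bar>Re (contour_integral ?L ?p)\<bar> \<le> C2" "\<bar>Re (contour_integral ?U ?m)\<bar> \<le> C2"
      using Lp Um abs_Re_le_cmod order_trans by blast+
    moreover have "\<bar>pi * Im ?c / 2\<bar> \<le> pi * \<bar>Im ?c\<bar>" by (simp add: abs_mult)
    ultimately show ?thesis unfolding eq by blast
  qed
  then show ?thesis by blast
qed

text \<open>The reflection \<open>z \<mapsto> Q - z\<close> preserves the substrip and reverses the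
  signs of \<open>Im z\<close>, of \<open>Q/2 - Re z\<close> and of the logarithm, so the lower
  half-plane follows from the upper one.\<close>

lemma Re_log_double_sine_asymp:
  assumes "0 < b" "b < 1" "0 < \<delta>"
  obtains C where "0 \<le> C" "\<And>z. \<delta> \<le> Re z \<Longrightarrow> Re z \<le> Qb b - \<delta> \<Longrightarrow>
    \<bar>Re (log_double_sine b z) + pi * (Qb b / 2 - Re z) * \<bar>Im z\<bar>\<bar> \<le> C"
proof -
  obtain C where C: "\<And>z. \<delta> \<le> Re z \<Longrightarrow> Re z \<le> Qb b - \<delta> \<Longrightarrow> 0 \<le> Im z \<Longrightarrow>
    \<bar>Re (log_double_sine b z) + pi * (Qb b / 2 - Re z) * Im z\<bar> \<le> C"
    using Re_log_double_sine_asymp_upper[OF assms] by blast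
  have "\<bar>Re (log_double_sine b z) + pi * (Qb b / 2 - Re z) * \<bar>Im z\<bar>\<bar> \<le> \<bar>C\<bar>"
    if z: "\<delta> \<le> Re z" "Re z \<le> Qb b - \<delta>" for z
  proof (cases "0 \<le> Im z")
    case True with C[OF z] show ?thesis by simp
  next
    case False
    with C[of "of_real (Qb b) - z"] z show ?thesis
      by (simp add: log_double_sine_reflect algebra_simps)
  qed
  then show ?thesis using that[of "\<bar>C\<bar>"] by auto
qed

section \<open>Holomorphy in the open strip\<close>

lemma open_Re_strip: "open {z::complex. a < Re z \<and> Re z < c}"
  by (intro open_Collect_conj open_halfspace_Re_gt open_halfspace_Re_lt)

lemma convex_Re_strip: "convex {z::complex. a < Re z \<and> Re z < c}"
  using convex_Int[OF convex_halfspace_Re_gt[of a] convex_halfspace_Re_lt[of c]]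
  by (simp add: Collect_conj_eq)

lemma dsine_kernel_den_nonzero:
  assumes "0 < b" "b < 1" "t \<noteq> 0" "cmod t < 2 * pi * b \<or> t \<in> \<real>"
  shows "4 * t * sinh (of_real b * t / 2) * sinh (t / (2 * of_real b)) \<noteq> 0"
  using assms(4)
proof
  assume t: "cmod t < 2 * pi * b"
  have "b * cmod t \<le> 1 * cmod t" using assms by (intro mult_right_mono) auto
  also have "\<dots> < 2 * pi * b" using t by simp
  also have "\<dots> \<le> 2 * pi * 1" using assms by (intro mult_left_mono) auto
  finally have "cmod (of_real b * t / 2) < pi" using assms by (simp add: norm_mult)
  moreover have "cmod (t / (2 * of_real b)) < pi"
    using t assms by (simp add: norm_mult norm_divide field_simps)
  ultimately have "sinhc (of_real b * t / 2) \<noteq> 0" "sinhc (t / (2 * of_real b)) \<noteq> 0"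
    by (simp_all only: sinhc_nonzero not_False_eq_True)
  with assms show ?thesis by (auto simp: sinhc_def)
next
  assume "t \<in> \<real>"
  then obtain x where x: "t = of_real x" by (auto elim: Reals_cases)
  have "of_real b * t / 2 = complex_of_real (b * x / 2)"
      "t / (2 * of_real b) = complex_of_real (x / (2 * b))" by (auto simp: x)
  then show ?thesis using assms x
    by (simp only: sinh_complex_of_real) simp
qed

definition dsine_kernel_deriv :: "real \<Rightarrow> complex \<Rightarrow> complex \<Rightarrow> complex" where
  "dsine_kernel_deriv b z t =
     - cosh ((of_real (Qb b) / 2 - z) * t) * t /
     (4 * t * sinh (of_real b * t / 2) * sinh (t / (2 * of_real b)))"

lemma has_field_derivative_dsine_kernel:
  "((\<lambda>z. dsine_kernel b z t) has_field_derivative dsine_kernel_deriv b z t) (at z within U)"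
  unfolding dsine_kernel_def dsine_kernel_deriv_def divide_inverse
  by (rule derivative_eq_intros refl | simp)+

lemma continuous_on_dsine_kernel:
  assumes "0 < b" "b < 1"
    and "continuous_on A f" "continuous_on A g"
    and "\<And>x. x \<in> A \<Longrightarrow> g x \<noteq> 0 \<and> (cmod (g x) < 2 * pi * b \<or> g x \<in> \<real>)"
  shows "continuous_on A (\<lambda>x. dsine_kernel b (f x) (g x))"
    and "continuous_on A (\<lambda>x. dsine_kernel_deriv b (f x) (g x))"
  unfolding dsine_kernel_def dsine_kernel_deriv_def
  using assms dsine_kernel_den_nonzero[OF assms(1,2)] by (auto intro!: continuous_intros)

text \<open>Differentiation under the integral sign. Here \<open>g\<close> is a path and
  \<open>h\<close> its velocity, so that the arc and the truncated ray are both instances; the last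
  hypothesis keeps the path off the poles of the kernel.\<close>

lemma holomorphic_on_integral_dsine_kernel:
  assumes "0 < b" "b < 1"
    and "continuous_on {u..v} g" "continuous_on {u..v} h"
    and "\<And>x. x \<in> {u..v} \<Longrightarrow> g x \<noteq> 0 \<and> (cmod (g x) < 2 * pi * b \<or> g x \<in> \<real>)"
  shows "(\<lambda>z. integral {u..v} (\<lambda>x::real. dsine_kernel b z (g x) * h x)) holomorphic_on UNIV"
  unfolding box_real(2)[symmetric]
proof (rule leibniz_rule_holomorphic)
  show "((\<lambda>z. dsine_kernel b z (g x) * h x) has_field_derivative dsine_kernel_deriv b z (g x) * h x) (at z within UNIV)" for z x
    by (rule DERIV_cmult_right[OF has_field_derivative_dsine_kernel])
  show "(\<lambda>x. dsine_kernel b z (g x) * h x) integrable_on cbox u v" for z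
    unfolding box_real(2)
    by (intro integrable_continuous_interval continuous_on_mult continuous_on_dsine_kernel continuous_on_const assms)
  have "continuous_on (UNIV \<times> {u..v}) (\<lambda>y. dsine_kernel_deriv b (fst y) (g (snd y)) * h (snd y))"
    using assms(5)
    by (intro continuous_on_mult continuous_on_dsine_kernel(2)[OF assms(1,2)] continuous_on_fst continuous_on_id
      continuous_on_compose2[OF assms(3)] continuous_on_compose2[OF assms(4)] continuous_on_snd; use assms(5) in force)
  then show "continuous_on (UNIV \<times> cbox u v) (\<lambda>(z, x). dsine_kernel_deriv b z (g x) * h x)"
    by (simp add: case_prod_beta')
qed auto

text \<open>The arc is compact. The ray integral is the locally uniform limit of its truncations,
  because the tails decay uniformly on closed substrips.\<close>

lemma holomorphic_log_double_sine:
  assumes "0 < b" "b < 1"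
  shows "log_double_sine b holomorphic_on {z. 0 < Re z \<and> Re z < Qb b}"
proof -
  let ?r = "pi * b" and ?S = "{z. 0 < Re z \<and> Re z < Qb b}"
  have r: "0 < ?r" using assms by simp
  have "(\<lambda>z. integral {0..pi} (\<lambda>x. dsine_kernel b z (0 + of_real ?r * cis x) * (of_real ?r * \<i> * cis x))) holomorphic_on UNIV"
    by (rule holomorphic_on_integral_dsine_kernel[OF assms])
      (use assms in \<open>auto simp: norm_mult intro!: continuous_intros\<close>)
  then have "(\<lambda>z. - integral {0..pi} (\<lambda>x. dsine_kernel b z (0 + of_real ?r * cis x) * (of_real ?r * \<i> * cis x))) holomorphic_on ?S"
    by (intro holomorphic_on_minus) (rule holomorphic_on_subset, auto)
  moreover have "contour_integral (part_circlepath 0 ?r pi 0) (dsine_kernel b z) =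
      - integral {0..pi} (\<lambda>x. dsine_kernel b z (0 + of_real ?r * cis x) * (of_real ?r * \<i> * cis x))" for z
    by (subst contour_integral_part_circlepath_reverse)
      (simp add: contour_integral_part_circlepath_eq mult.assoc)
  ultimately have arc: "(\<lambda>z. contour_integral (part_circlepath 0 ?r pi 0) (dsine_kernel b z)) holomorphic_on ?S"
    by simp
  let ?f = "\<lambda>n z. integral {?r..?r + real n} (\<lambda>x. dsine_kernel b z (of_real x) * 1)"
  let ?g = "\<lambda>z. LINT t:{?r..}|lborel. dsine_kernel b z (complex_of_real t)"
  have "?g holomorphic_on ?S"
  proof (rule holomorphic_uniform_sequence)
    show "open ?S" by (rule open_Re_strip)
    show "?f n holomorphic_on ?S" for n
      by (rule holomorphic_on_subset[OF holomorphic_on_integral_dsine_kernel[OF assms]])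
        (use r in \<open>auto intro!: continuous_intros\<close>)
    fix z assume z: "z \<in> ?S"
    \<comment> \<open>Half the distance to the nearer boundary line: the closed disc of this radius
      about \<open>z\<close> stays \<open>\<delta>\<close> away from both lines, as the tail
      estimate demands.\<close>
    define \<delta> where "\<delta> = min (Re z) (Qb b - Re z) / 2"
    have \<delta>: "0 < \<delta>" using z by (auto simp: \<delta>_def)
    have cb: "\<delta> \<le> Re x \<and> Re x \<le> Qb b - \<delta>" if "x \<in> cball z \<delta>" for x
    proof -
      have "2 * \<delta> \<le> Re z" "2 * \<delta> \<le> Qb b - Re z" by (auto simp: \<delta>_def)
      moreover have "\<bar>Re z - Re x\<bar> \<le> \<delta>"
        using that abs_Re_le_cmod[of "z - x"] by (simp add: dist_norm)
      ultimately show ?thesis by linarith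
    qed
    obtain C where C: "0 \<le> C" "\<And>z s A. \<delta> \<le> Re z \<Longrightarrow> Re z \<le> Qb b - \<delta> \<Longrightarrow> ?r \<le> s \<Longrightarrow> A \<subseteq> {s..} \<Longrightarrow> A \<in> sets borel \<Longrightarrow>
      set_integrable lborel A (\<lambda>t. dsine_kernel b z (complex_of_real t)) \<and>
      cmod (LINT t:A|lborel. dsine_kernel b z (complex_of_real t)) \<le> C * exp (- \<delta> * s)"
      using dsine_kernel_tail[OF assms(1) \<delta>] by metis
    have est: "dist (?f n x) (?g x) \<le> C * exp (- \<delta> * (?r + real n))" if "x \<in> cball z \<delta>" for n x
    proof -
      let ?A = "{?r..?r + real n}" and ?B = "{?r + real n<..}"
      note C' = C(2)[of x, OF conjunct1[OF cb[OF that]] conjunct2[OF cb[OF that]]]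
      have sub: "?B \<subseteq> {?r + real n..}" by auto
      have A: "set_integrable lborel ?A (\<lambda>t. dsine_kernel b x (complex_of_real t))"
        using C'[of ?r ?A] by auto
      have B: "set_integrable lborel ?B (\<lambda>t. dsine_kernel b x (complex_of_real t))"
        "cmod (LINT t:?B|lborel. dsine_kernel b x (complex_of_real t)) \<le> C * exp (- \<delta> * (?r + real n))"
        using C'[of "?r + real n" ?B, OF _ sub] by auto
      have "{?r..} = ?A \<union> ?B" "?A \<inter> ?B = {}" by auto
      then have "?g x = (LINT t:?A|lborel. dsine_kernel b x (complex_of_real t)) +
         (LINT t:?B|lborel. dsine_kernel b x (complex_of_real t))"
        using A B(1) by (simp add: set_integral_Un)
      also have "(LINT t:?A|lborel. dsine_kernel b x (complex_of_real t)) = ?f n x"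
        using set_borel_integral_eq_integral(2)[OF A] by simp
      finally show ?thesis using B(2) by (simp add: dist_norm)
    qed
    have "uniform_limit (cball z \<delta>) ?f ?g sequentially"
    proof (rule uniform_limitI)
      fix e :: real assume "0 < e"
      have "(\<lambda>n. C * exp (- \<delta> * (?r + real n))) \<longlonglongrightarrow> 0"
        using \<delta> by real_asymp
      then have "\<forall>\<^sub>F n in sequentially. C * exp (- \<delta> * (?r + real n)) < e"
        using \<open>0 < e\<close> by (rule order_tendstoD)
      then show "\<forall>\<^sub>F n in sequentially. \<forall>x\<in>cball z \<delta>. dist (?f n x) (?g x) < e"
        by eventually_elim (use est in \<open>blast intro: le_less_trans\<close>)
    qed
    moreover have "cball z \<delta> \<subseteq> ?S" using cb \<delta> by force
    ultimately show "\<exists>d>0. cball z d \<subseteq> ?S \<and> uniform_limit (cball z d) ?f ?g sequentially"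
      using \<delta> by blast
  qed
  with arc show ?thesis
    by (subst log_double_sine_eq [abs_def]) (intro holomorphic_intros)
qed

section \<open>Values and growth of the double sine function\<close>

lemma double_sine_strip:
  assumes "0 < Re z" "Re z < Qb b"
  shows "double_sine b z = exp (log_double_sine b z)"
proof -
  have "(LEAST n::nat. Re z - real n * b < Qb b) = 0"
    using assms by (intro Least_equality) auto
  with assms show ?thesis by (simp add: double_sine_def)
qed

text \<open>Twice a colour has real part \<open>Q\<close>, on the boundary of the strip, so exactly
  one step of the functional equation is taken there.\<close>

lemma double_sine_Re_Qb:
  assumes "0 < b" "Re z = Qb b"
  shows "double_sine b z = 2 * sin (of_real (pi * b) * (z - of_real b)) * exp (log_double_sine b (z - of_real b))"
proof -
  have "(LEAST n::nat. Re z - real n * b < Qb b) = 1"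
  proof (intro Least_equality)
    fix n :: nat assume "Re z - real n * b < Qb b"
    then show "1 \<le> n" using assms by (cases n) auto
  qed (use assms in auto)
  with assms Qb_pos[of b] show ?thesis by (simp add: double_sine_def)
qed

lemma holomorphic_double_sine:
  assumes "0 < b" "b < 1"
  shows "double_sine b holomorphic_on {z. 0 < Re z \<and> Re z < Qb b}"
proof -
  have "(\<lambda>z. exp (log_double_sine b z)) holomorphic_on {z. 0 < Re z \<and> Re z < Qb b}"
    by (intro holomorphic_intros holomorphic_log_double_sine assms)
  then show ?thesis by (rule holomorphic_transform) (auto simp: double_sine_strip)
qed

lemma double_sine_bound:
  assumes "0 < b" "b < 1" "0 < \<delta>"
  obtains C where "1 \<le> C" "\<And>z. \<delta> \<le> Re z \<Longrightarrow> Re z \<le> Qb b - \<delta> \<Longrightarrow>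
    cmod (double_sine b z) \<le> C * exp (- pi * (Qb b / 2 - Re z) * \<bar>Im z\<bar>)"
proof -
  obtain C where C: "0 \<le> C" "\<And>z. \<delta> \<le> Re z \<Longrightarrow> Re z \<le> Qb b - \<delta> \<Longrightarrow>
    \<bar>Re (log_double_sine b z) + pi * (Qb b / 2 - Re z) * \<bar>Im z\<bar>\<bar> \<le> C"
    using Re_log_double_sine_asymp[OF assms] by blast
  have "cmod (double_sine b z) \<le> exp C * exp (- pi * (Qb b / 2 - Re z) * \<bar>Im z\<bar>)"
    if "\<delta> \<le> Re z" "Re z \<le> Qb b - \<delta>" for z
    using C(2)[OF that] that assms by (subst double_sine_strip) (auto simp flip: exp_add simp: abs_le_iff)
  then show ?thesis using that[of "exp C"] C(1) by auto
qed

text \<open>With \<open>w = 2 a - b\<close> the value is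
  \<open>2 sin (\<pi> b w) S\<^sub>b(w)\<close>. The sine has the rate \<open>2 \<pi> b\<close>, and
  the asymptotics at \<open>Re w = 1/b\<close> contribute \<open>\<pi> (1/b - b)\<close>. Together
  this is \<open>\<pi> Q\<close>, doubled by the square.\<close>

lemma edge_weight_bound:
  assumes "0 < b" "b < 1"
  obtains C where "0 \<le> C" "\<And>y e. 0 < y e \<Longrightarrow> edge_weight b (colour b y e) \<le> C * exp (2 * pi * Qb b * y e)"
proof -
  obtain C where C: "0 \<le> C" "\<And>z. b \<le> Re z \<Longrightarrow> Re z \<le> Qb b - b \<Longrightarrow>
    \<bar>Re (log_double_sine b z) + pi * (Qb b / 2 - Re z) * \<bar>Im z\<bar>\<bar> \<le> C"
    using Re_log_double_sine_asymp[OF assms assms(1)] by blast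
  have "edge_weight b (colour b y e) \<le> (2 * exp C)\<^sup>2 * exp (2 * pi * Qb b * y e)" if y: "0 < y e" for y :: "'a \<Rightarrow> real" and e
  proof -
    define w where "w = Complex (1 / b) (2 * y e)"
    have w: "2 * colour b y e - of_real b = w" "Re (2 * colour b y e) = Qb b"
      by (auto simp: w_def complex_eq_iff colour_def Qb_def add_divide_distrib)
    have q: "Qb b / 2 - 1 / b = - ((1 / b - b) / 2)"
      by (simp add: Qb_def add_divide_distrib diff_divide_distrib)
    \<comment> \<open>Since \<open>Q - 1/b = b\<close>, this places \<open>w\<close> in the closed
      substrip of margin \<open>b\<close>.\<close>
    have "b \<le> 1 / b" using assms mult_mono[of b 1 b 1] by (simp add: field_simps)
    then have L: "Re (log_double_sine b w) \<le> C + pi * (1 / b - b) * y e"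
      using C(2)[of w] y q by (simp add: w_def abs_le_iff) (simp add: Qb_def)
    have "cmod (sin (of_real (pi * b) * w)) \<le> exp (2 * pi * b * y e)"
      using norm_sinh_le[of "\<i> * (of_real (pi * b) * w)"] assms y
      by (simp add: sin_conv_sinh norm_mult w_def abs_mult mult_ac)
    then have "cmod (double_sine b (2 * colour b y e)) \<le> 2 * exp (2 * pi * b * y e) * exp (C + pi * (1 / b - b) * y e)"
      unfolding double_sine_Re_Qb[OF assms(1) w(2)] w(1) using L
      by (simp only: norm_mult norm_exp_eq_Re) (intro mult_mono, auto)
    also have "\<dots> = 2 * exp C * exp (pi * Qb b * y e)"
      by (simp add: Qb_def algebra_simps flip: exp_add)
    finally have "edge_weight b (colour b y e) \<le> (2 * exp C * exp (pi * Qb b * y e))\<^sup>2"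
      unfolding edge_weight_def by (intro power_mono) auto
    also have "\<dots> = (2 * exp C)\<^sup>2 * exp (2 * pi * Qb b * y e)"
      by (simp add: power_mult_distrib exp_double mult_ac flip: exp_of_nat_mult)
    finally show ?thesis .
  qed
  then show ?thesis by (intro that[of "(2 * exp C)\<^sup>2"]) auto
qed

section \<open>Decay of the b-6j symbol\<close>

lemma integrable_exp_abs:
  assumes "0 < a" shows "integrable lborel (\<lambda>y::real. exp (- a * \<bar>y\<bar>))"
proof -
  let ?f = "\<lambda>y::real. indicator {0..} y *\<^sub>R exp (- a * y)"
  have f: "integrable lborel ?f"
    using exp_minus_set_integral(1)[OF assms, of 0] by (simp add: set_integrable_def)
  then have "integrable lborel (\<lambda>y. ?f (0 + (- 1) * y))"
    by (rule lborel_integrable_real_affine) simp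
  with f have "integrable lborel (\<lambda>y. ?f y + ?f (0 + (- 1) * y))"
    by (rule Bochner_Integration.integrable_add)
  then show ?thesis
    by (rule Bochner_Integration.integrable_bound) (auto simp: indicator_def split: if_splits)
qed

lemma continuous_on_Complex_line: "continuous_on A (Complex x)"
  unfolding Complex_eq by (intro continuous_intros)

lemma vertical_line_integrable:
  assumes "continuous_on UNIV (\<lambda>y. f (Complex x y))" "0 < a"
    and "\<And>y. cmod (f (Complex x y)) \<le> C * exp (- a * \<bar>y\<bar>)"
  shows "integrable lborel (\<lambda>y. f (Complex x y))"
    and "cmod (LINT y|lborel. f (Complex x y)) \<le> C * (LINT y|lborel. exp (- a * \<bar>y\<bar>))"
proof -
  have g: "integrable lborel (\<lambda>y. C * exp (- a * \<bar>y\<bar>))"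
    by (intro integrable_mult_right integrable_exp_abs assms)
  show f: "integrable lborel (\<lambda>y. f (Complex x y))"
  proof (rule Bochner_Integration.integrable_bound[OF g])
    show "(\<lambda>y. f (Complex x y)) \<in> borel_measurable lborel"
      using borel_measurable_continuous_onI[OF assms(1)] by simp
    show "AE y in lborel. cmod (f (Complex x y)) \<le> norm (C * exp (- a * \<bar>y\<bar>))"
      using assms(3) by (intro always_eventually allI) (metis abs_ge_self order_trans real_norm_def)
  qed
  have "cmod (LINT y|lborel. f (Complex x y)) \<le> (LINT y|lborel. C * exp (- a * \<bar>y\<bar>))"
    by (rule Bochner_Integration.integral_norm_bound_integral[OF f g assms(3)])
  then show "cmod (LINT y|lborel. f (Complex x y)) \<le> C * (LINT y|lborel. exp (- a * \<bar>y\<bar>))"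
    by simp
qed

lemma vertical_line_integral_limit:
  fixes f :: "complex \<Rightarrow> complex"
  assumes "integrable lborel (\<lambda>y. f (Complex x y))"
  shows "(\<lambda>n. integral {- real n..real n} (\<lambda>y. f (Complex x y))) \<longlonglongrightarrow> (LINT y|lborel. f (Complex x y))"
proof -
  let ?h = "\<lambda>y. f (Complex x y)"
  have "set_integrable lborel {- real n..real n} ?h" for n
    unfolding set_integrable_def by (rule integrable_mult_indicator[OF _ assms]) simp
  then have eq: "integral {- real n..real n} ?h = (LINT y|lborel. indicator {- real n..real n} y *\<^sub>R ?h y)" for n
    using set_borel_integral_eq_integral(2) by (metis set_lebesgue_integral_def)
  have "(\<lambda>n. LINT y|lborel. indicator {- real n..real n} y *\<^sub>R ?h y) \<longlonglongrightarrow> (LINT y|lborel. ?h y)"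
  proof (rule integral_dominated_convergence[where w = "\<lambda>y. cmod (?h y)"])
    show "AE y in lborel. (\<lambda>n. indicator {- real n..real n} y *\<^sub>R ?h y) \<longlonglongrightarrow> ?h y"
    proof (rule always_eventually, rule allI, rule tendsto_eventually)
      fix y
      show "\<forall>\<^sub>F n in sequentially. indicator {- real n..real n} y *\<^sub>R ?h y = ?h y"
        using eventually_ge_at_top[of "nat \<lceil>\<bar>y\<bar>\<rceil>"]
        by eventually_elim (auto simp: indicator_def nat_le_iff ceiling_le_iff)
    qed
  qed (use assms in \<open>auto simp: indicator_def intro: borel_measurable_integrable\<close>)
  then show ?thesis by (simp add: eq)
qed

text \<open>A primitive on the convex strip turns a truncated vertical integral into a difference of
  end values. Two lines then differ by increments of the primitive along two horizontal segments,
  which vanish in the limit by the decay of \<open>f\<close>.\<close>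

lemma vertical_line_shift:
  fixes f :: "complex \<Rightarrow> complex"
  assumes hol: "f holomorphic_on {z. l < Re z \<and> Re z < r}" and x: "l < x1" "x1 \<le> x2" "x2 < r" and a: "0 < a"
    and bound: "\<And>z. x1 \<le> Re z \<Longrightarrow> Re z \<le> x2 \<Longrightarrow> cmod (f z) \<le> C * exp (- a * \<bar>Im z\<bar>)"
  shows "(LINT y|lborel. f (Complex x1 y)) = (LINT y|lborel. f (Complex x2 y))"
proof -
  let ?S = "{z. l < Re z \<and> Re z < r}"
  obtain F where F: "\<And>z. z \<in> ?S \<Longrightarrow> (F has_field_derivative f z) (at z within ?S)"
    using holomorphic_convex_primitive'[OF convex_Re_strip open_Re_strip hol] by blast
  then have F': "(F has_field_derivative f z) (at z)" if "z \<in> ?S" for z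
    using that by (metis at_within_open[OF _ open_Re_strip])
  have cont: "continuous_on UNIV (\<lambda>y. f (Complex x y))" if "l < x" "x < r" for x
    by (rule continuous_on_compose2[OF holomorphic_on_imp_continuous_on[OF hol] continuous_on_Complex_line])
      (use that in auto)
  have int: "integral {- R..R} (\<lambda>y. f (Complex x y) * \<i>) = F (Complex x R) - F (Complex x (- R))"
    if "l < x" "x < r" "0 \<le> R" for x R
  proof (rule integral_unique, rule fundamental_theorem_of_calculus)
    fix y
    have "((\<lambda>y. of_real x + \<i> * of_real y) has_vector_derivative \<i>) (at y)"
      by (auto intro!: derivative_eq_intros simp: has_vector_derivative_def scaleR_conv_of_real mult.commute)
    then have "(Complex x has_vector_derivative \<i>) (at y)"
      by (simp add: Complex_eq [abs_def])
    from field_vector_diff_chain_at[OF this F'[of "Complex x y"]]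
    have "((\<lambda>y. F (Complex x y)) has_vector_derivative \<i> * f (Complex x y)) (at y)"
      using that by (simp add: o_def)
    then show "((\<lambda>y. F (Complex x y)) has_vector_derivative f (Complex x y) * \<i>) (at y within {- R..R})"
      by (simp add: has_vector_derivative_at_within mult.commute)
  qed (use that in simp)
  have edge: "cmod (F (Complex x2 R) - F (Complex x1 R)) \<le> C * exp (- a * \<bar>R\<bar>) * (x2 - x1)" for R
  proof -
    \<comment> \<open>The horizontal segment at height \<open>R\<close>, written as an intersection
      of half-planes so that convexity is immediate.\<close>
    let ?L = "{z. R \<le> Im z} \<inter> {z. Im z \<le> R} \<inter> {z. x1 \<le> Re z} \<inter> {z. Re z \<le> x2}"
    have "cmod (F (Complex x2 R) - F (Complex x1 R)) \<le> C * exp (- a * \<bar>R\<bar>) * cmod (Complex x2 R - Complex x1 R)"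
    proof (rule field_differentiable_bound[where S = ?L])
      show "convex ?L"
        by (intro convex_Int convex_halfspace_Im_ge convex_halfspace_Im_le convex_halfspace_Re_ge convex_halfspace_Re_le)
      show "(F has_field_derivative f z) (at z within ?L)" if "z \<in> ?L" for z
        using that x by (intro has_field_derivative_at_within[OF F']) auto
    qed (use bound x in auto)
    also have "cmod (Complex x2 R - Complex x1 R) = x2 - x1"
      using x by (simp add: cmod_def)
    finally show ?thesis .
  qed
  have "(\<lambda>n. integral {- real n..real n} (\<lambda>y. f (Complex x2 y)) - integral {- real n..real n} (\<lambda>y. f (Complex x1 y))) \<longlonglongrightarrow> 0"
  proof (rule Lim_null_comparison)
    show "(\<lambda>n. 2 * (C * exp (- a * \<bar>real n\<bar>) * (x2 - x1))) \<longlonglongrightarrow> 0"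
      using a by real_asymp
    show "\<forall>\<^sub>F n in sequentially. norm (integral {- real n..real n} (\<lambda>y. f (Complex x2 y)) - integral {- real n..real n} (\<lambda>y. f (Complex x1 y)))
       \<le> 2 * (C * exp (- a * \<bar>real n\<bar>) * (x2 - x1))"
    proof (intro always_eventually allI)
      fix n
      let ?I = "\<lambda>x. integral {- real n..real n} (\<lambda>y. f (Complex x y))"
      have "(?I x2 - ?I x1) * \<i> = (F (Complex x2 (real n)) - F (Complex x1 (real n))) - (F (Complex x2 (- real n)) - F (Complex x1 (- real n)))"
        using int[of x2 "real n"] int[of x1 "real n"] x by (simp add: left_diff_distrib)
      then have "cmod (?I x2 - ?I x1) = cmod ((F (Complex x2 (real n)) - F (Complex x1 (real n))) - (F (Complex x2 (- real n)) - F (Complex x1 (- real n))))"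
        by (metis mult.right_neutral norm_ii norm_mult)
      also have "\<dots> \<le> C * exp (- a * \<bar>real n\<bar>) * (x2 - x1) + C * exp (- a * \<bar>- real n\<bar>) * (x2 - x1)"
        by (rule order_trans[OF norm_triangle_ineq4 add_mono[OF edge edge]])
      finally show "norm (?I x2 - ?I x1) \<le> 2 * (C * exp (- a * \<bar>real n\<bar>) * (x2 - x1))" by (simp add: mult_ac)
    qed
  qed
  moreover have "integrable lborel (\<lambda>y. f (Complex x y))" if "x1 \<le> x" "x \<le> x2" for x
  proof (rule vertical_line_integrable(1)[OF cont a])
    show "cmod (f (Complex x y)) \<le> C * exp (- a * \<bar>y\<bar>)" for y
      using bound[of "Complex x y"] that by simp
  qed (use that x in auto)
  moreover from this have "(\<lambda>n. integral {- real n..real n} (\<lambda>y. f (Complex x2 y)) - integral {- real n..real n} (\<lambda>y. f (Complex x1 y)))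
      \<longlonglongrightarrow> (LINT y|lborel. f (Complex x2 y)) - (LINT y|lborel. f (Complex x1 y))"
    using x by (intro tendsto_diff vertical_line_integral_limit) auto
  ultimately show ?thesis using LIMSEQ_unique by fastforce
qed

section \<open>The integrand of the symbol and its decay\<close>

text \<open>All \<open>t_i\<close> have real part \<open>3Q/2\<close> and all \<open>q_j\<close>
  have real part \<open>2Q\<close>. Only the imaginary parts are variable, and the estimates below
  are uniform in them.\<close>

definition sixj_kernel :: "real \<Rightarrow> (nat \<Rightarrow> real) \<Rightarrow> (nat \<Rightarrow> real) \<Rightarrow> complex \<Rightarrow> complex" where
  "sixj_kernel b \<tau> \<kappa> u =
     (\<Prod>i=1..4. double_sine b (u - Complex (3/2 * Qb b) (\<tau> i))) *
     (\<Prod>j=1..4. double_sine b (Complex (2 * Qb b) (\<kappa> j) - u))"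

lemma holomorphic_sixj_kernel:
  assumes "0 < b" "b < 1"
  shows "sixj_kernel b \<tau> \<kappa> holomorphic_on {u. 3/2 * Qb b < Re u \<and> Re u < 2 * Qb b}"
proof -
  have "(\<lambda>u. double_sine b (u - Complex (3/2 * Qb b) (\<tau> i))) holomorphic_on {u. 3/2 * Qb b < Re u \<and> Re u < 2 * Qb b}"
    "(\<lambda>u. double_sine b (Complex (2 * Qb b) (\<kappa> i) - u)) holomorphic_on {u. 3/2 * Qb b < Re u \<and> Re u < 2 * Qb b}" for i
    using Qb_pos[OF assms(1)]
    by (intro holomorphic_on_compose_gen[OF _ holomorphic_double_sine[OF assms], unfolded o_def];
        auto intro!: holomorphic_intros)+
  then show ?thesis unfolding sixj_kernel_def [abs_def] by (intro holomorphic_intros)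
qed

text \<open>The asymptotics at \<open>Re (u - t_i) = Re u - 3Q/2\<close> give the rate
  \<open>2Q - Re u\<close>, those at \<open>Re (q_j - u) = 2Q - Re u\<close> the rate
  \<open>Re u - 3Q/2\<close>. Inside the strip both are positive, and they add up to
  \<open>Q/2\<close>.\<close>

lemma sixj_kernel_bound:
  assumes "0 < b" "b < 1" "0 < \<delta>"
  obtains C where "0 \<le> C" "\<And>\<tau> \<kappa> u. 3/2 * Qb b + \<delta> \<le> Re u \<Longrightarrow> Re u \<le> 2 * Qb b - \<delta> \<Longrightarrow>
    cmod (sixj_kernel b \<tau> \<kappa> u) \<le> C * exp (- (pi * (2 * Qb b - Re u) * (\<Sum>i=1..4. \<bar>Im u - \<tau> i\<bar>) +
       pi * (Re u - 3/2 * Qb b) * (\<Sum>j=1..4. \<bar>Im u - \<kappa> j\<bar>)))"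
proof -
  obtain C where C: "1 \<le> C" "\<And>z. \<delta> \<le> Re z \<Longrightarrow> Re z \<le> Qb b - \<delta> \<Longrightarrow>
    cmod (double_sine b z) \<le> C * exp (- pi * (Qb b / 2 - Re z) * \<bar>Im z\<bar>)"
    using double_sine_bound[OF assms] by blast
  have "cmod (sixj_kernel b \<tau> \<kappa> u) \<le> C ^ 4 * C ^ 4 * exp (- (pi * (2 * Qb b - Re u) * (\<Sum>i=1..4. \<bar>Im u - \<tau> i\<bar>) +
       pi * (Re u - 3/2 * Qb b) * (\<Sum>j=1..4. \<bar>Im u - \<kappa> j\<bar>)))"
    if u: "3/2 * Qb b + \<delta> \<le> Re u" "Re u \<le> 2 * Qb b - \<delta>" for \<tau> \<kappa> u
  proof -
    have Q: "0 < Qb b" using assms by (simp add: Qb_pos)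
    have "cmod (double_sine b (u - Complex (3/2 * Qb b) (\<tau> i))) \<le> C * exp (- (pi * (2 * Qb b - Re u) * \<bar>Im u - \<tau> i\<bar>))" for i
      using C(2)[of "u - Complex (3/2 * Qb b) (\<tau> i)"] u Q by (simp add: algebra_simps)
    then have 1: "cmod (\<Prod>i=1..4. double_sine b (u - Complex (3/2 * Qb b) (\<tau> i))) \<le>
        (\<Prod>i=1..(4::nat). C * exp (- (pi * (2 * Qb b - Re u) * \<bar>Im u - \<tau> i\<bar>)))"
      unfolding prod_norm [symmetric] by (intro prod_mono) auto
    have "cmod (double_sine b (Complex (2 * Qb b) (\<kappa> j) - u)) \<le> C * exp (- (pi * (Re u - 3/2 * Qb b) * \<bar>Im u - \<kappa> j\<bar>))" for j
      using C(2)[of "Complex (2 * Qb b) (\<kappa> j) - u"] u Q by (simp add: algebra_simps abs_minus_commute)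
    then have 2: "cmod (\<Prod>j=1..4. double_sine b (Complex (2 * Qb b) (\<kappa> j) - u)) \<le>
        (\<Prod>j=1..(4::nat). C * exp (- (pi * (Re u - 3/2 * Qb b) * \<bar>Im u - \<kappa> j\<bar>)))"
      unfolding prod_norm [symmetric] by (intro prod_mono) auto
    have "cmod (sixj_kernel b \<tau> \<kappa> u) \<le> (\<Prod>i=1..(4::nat). C * exp (- (pi * (2 * Qb b - Re u) * \<bar>Im u - \<tau> i\<bar>))) *
       (\<Prod>j=1..(4::nat). C * exp (- (pi * (Re u - 3/2 * Qb b) * \<bar>Im u - \<kappa> j\<bar>)))"
      unfolding sixj_kernel_def norm_mult using C(1) by (intro mult_mono 1 2 prod_nonneg) auto
    also have "\<dots> = C ^ 4 * C ^ 4 * exp (- (pi * (2 * Qb b - Re u) * (\<Sum>i=1..4. \<bar>Im u - \<tau> i\<bar>) +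
       pi * (Re u - 3/2 * Qb b) * (\<Sum>j=1..4. \<bar>Im u - \<kappa> j\<bar>)))"
      by (simp only: prod.distrib prod_constant card_atLeastAtMost exp_sum [symmetric] finite_atLeastAtMost
          sum_negf sum_distrib_left [symmetric] exp_add minus_add_distrib) simp
    finally show ?thesis .
  qed
  then show ?thesis using that[of "C ^ 4 * C ^ 4"] C(1) by auto
qed

lemma sum_1_4: "(\<Sum>i=1..4::nat. f i) = f 1 + f 2 + f 3 + (f 4 :: 'a :: comm_monoid_add)"
  by (simp add: eval_nat_numeral add.assoc)

lemma prod_1_4: "(\<Prod>i=1..4::nat. f i) = f 1 * f 2 * f 3 * (f 4 :: 'a :: comm_monoid_mult)"
  by (simp add: eval_nat_numeral mult.assoc)

definition tau_im :: "(nat \<Rightarrow> real) \<Rightarrow> nat \<Rightarrow> real" where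
  "tau_im x i = [x 1 + x 2 + x 3, x 1 + x 5 + x 6, x 2 + x 4 + x 6, x 3 + x 4 + x 5] ! (i - 1)"

definition kappa_im :: "(nat \<Rightarrow> real) \<Rightarrow> nat \<Rightarrow> real" where
  "kappa_im x j = [x 1 + x 2 + x 4 + x 5, x 1 + x 3 + x 4 + x 6, x 2 + x 3 + x 5 + x 6, 0] ! (j - 1)"

lemma sixj_t_Complex:
  assumes "i \<in> {1..4}"
  shows "sixj_t (\<lambda>k. Complex (Qb b / 2) (x k)) i = Complex (3/2 * Qb b) (tau_im x i)"
proof -
  have "i = 1 \<or> i = 2 \<or> i = 3 \<or> i = 4" using assms by auto
  then show ?thesis by (auto simp: sixj_t_def tau_im_def complex_eq_iff nth_Cons')
qed

lemma sixj_q_Complex: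
  assumes "j \<in> {1..4}"
  shows "sixj_q b (\<lambda>k. Complex (Qb b / 2) (x k)) j = Complex (2 * Qb b) (kappa_im x j)"
proof -
  have "j = 1 \<or> j = 2 \<or> j = 3 \<or> j = 4" using assms by auto
  then show ?thesis by (auto simp: sixj_q_def kappa_im_def complex_eq_iff nth_Cons')
qed

lemma b6j_Complex:
  "b6j b (\<lambda>k. Complex (Qb b / 2) (x k)) =
     exp (- (1/2) * (\<Sum>i=1..4. \<Sum>j=1..4. log_double_sine b (Complex (Qb b / 2) (kappa_im x j - tau_im x i)))) *
     (LINT y|lborel. sixj_kernel b (tau_im x) (kappa_im x) (Complex (7/4 * Qb b) y))"
proof -
  have "Complex (2 * Qb b) (kappa_im x j) - Complex (3/2 * Qb b) (tau_im x i) = Complex (Qb b / 2) (kappa_im x j - tau_im x i)" for i j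
    by (simp add: complex_eq_iff)
  then show ?thesis
    by (simp add: b6j_def sixj_kernel_def sixj_t_Complex sixj_q_Complex Let_def)
qed

lemma kappa_im_values:
  "kappa_im x 1 = x 1 + x 2 + x 4 + x 5" "kappa_im x 2 = x 1 + x 3 + x 4 + x 6"
  "kappa_im x 3 = x 2 + x 3 + x 5 + x 6" "kappa_im x 4 = 0"
  by (auto simp: kappa_im_def nth_Cons')

lemma tau_im_values:
  "tau_im x 1 = x 1 + x 2 + x 3" "tau_im x 2 = x 1 + x 5 + x 6"
  "tau_im x 3 = x 2 + x 4 + x 6" "tau_im x 4 = x 3 + x 4 + x 5"
  by (auto simp: tau_im_def nth_Cons')

lemmas kappa_tau_simps = kappa_im_values kappa_im_values(1)[unfolded One_nat_def]
  tau_im_values tau_im_values(1)[unfolded One_nat_def]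

text \<open>Each distance is bounded below by a signed difference, with minus signs at
  \<open>\<tau> i\<close> and at the first three \<open>\<kappa>\<close>. Then \<open>y\<close>
  cancels. The first three \<open>\<kappa>\<close> and the four \<open>\<tau>\<close> have equal
  sums, each edge being counted twice in both, so \<open>2 \<tau> i\<close> remains.\<close>

lemma sum_dist_tau_kappa_ge:
  assumes "i \<in> {1..4}"
  shows "2 * tau_im x i \<le> (\<Sum>i=1..4. \<bar>y - tau_im x i\<bar>) + (\<Sum>j=1..4. \<bar>y - kappa_im x j\<bar>)"
proof -
  let ?k = "- (y - kappa_im x 1) + - (y - kappa_im x 2) + - (y - kappa_im x 3) + (y - kappa_im x 4)"
  let ?R = "(\<Sum>i=1..4. \<bar>y - tau_im x i\<bar>) + (\<Sum>j=1..4. \<bar>y - kappa_im x j\<bar>)"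
  have *: "- (y - tau_im x 1) + (y - tau_im x 2) + (y - tau_im x 3) + (y - tau_im x 4) + ?k \<le> ?R"
    "(y - tau_im x 1) + - (y - tau_im x 2) + (y - tau_im x 3) + (y - tau_im x 4) + ?k \<le> ?R"
    "(y - tau_im x 1) + (y - tau_im x 2) + - (y - tau_im x 3) + (y - tau_im x 4) + ?k \<le> ?R"
    "(y - tau_im x 1) + (y - tau_im x 2) + (y - tau_im x 3) + - (y - tau_im x 4) + ?k \<le> ?R"
    unfolding sum_1_4 by (intro add_mono abs_ge_self abs_ge_minus_self)+
  note * = *[THEN order_trans[rotated]]
  consider "i = 1" | "i = 2" | "i = 3" | "i = 4" using assms by force
  then show ?thesis
  proof cases
    case 1
    show ?thesis unfolding 1 by (rule *(1)) (simp add: kappa_tau_simps)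
  next
    case 2
    show ?thesis unfolding 2 by (rule *(2)) (simp add: kappa_tau_simps)
  next
    case 3
    show ?thesis unfolding 3 by (rule *(3)) (simp add: kappa_tau_simps)
  next
    case 4
    show ?thesis unfolding 4 by (rule *(4)) (simp add: kappa_tau_simps)
  qed
qed

text \<open>Two plus and two minus signs cancel \<open>y\<close>. Each of the first three
  \<open>\<kappa>\<close> is the total of all labels minus one pair of opposite edges, and the signs
  isolate twice the pair omitted by the third.\<close>

lemma sum_dist_kappa_ge:
  "2 * (x 1 + x 4) \<le> (\<Sum>j=1..4. \<bar>y - kappa_im x j\<bar>)"
  "2 * (x 2 + x 5) \<le> (\<Sum>j=1..4. \<bar>y - kappa_im x j\<bar>)"
  "2 * (x 3 + x 6) \<le> (\<Sum>j=1..4. \<bar>y - kappa_im x j\<bar>)"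
proof -
  let ?R = "\<Sum>j=1..4. \<bar>y - kappa_im x j\<bar>"
  have *: "- (y - kappa_im x 1) + - (y - kappa_im x 2) + (y - kappa_im x 3) + (y - kappa_im x 4) \<le> ?R"
    "- (y - kappa_im x 1) + (y - kappa_im x 2) + - (y - kappa_im x 3) + (y - kappa_im x 4) \<le> ?R"
    "(y - kappa_im x 1) + - (y - kappa_im x 2) + - (y - kappa_im x 3) + (y - kappa_im x 4) \<le> ?R"
    unfolding sum_1_4 by (intro add_mono abs_ge_self abs_ge_minus_self)+
  show "2 * (x 1 + x 4) \<le> ?R" by (rule order_trans[OF _ *(1)]) (simp add: kappa_tau_simps)
  show "2 * (x 2 + x 5) \<le> ?R" by (rule order_trans[OF _ *(2)]) (simp add: kappa_tau_simps)
  show "2 * (x 3 + x 6) \<le> ?R" by (rule order_trans[OF _ *(3)]) (simp add: kappa_tau_simps)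
qed

text \<open>One of the four points, \<open>q_4 = 2Q\<close>, is real. This gives decay along the
  line that is uniform in the labels.\<close>

lemma sum_dist_kappa_ge_abs: "\<bar>y\<bar> \<le> (\<Sum>j=1..4. \<bar>y - kappa_im x j\<bar>)"
proof -
  have "kappa_im x 4 = 0" by (simp add: kappa_im_def nth_Cons')
  then show ?thesis unfolding sum_1_4 by simp
qed

text \<open>A share \<open>1 - \<eta>\<close> of the exponent is estimated by the labels, and the
  share \<open>\<eta>\<close> by \<open>\<bar>y\<bar>\<close> to make the integral converge. For
  opposite edges a second factor \<open>1 - \<eta>\<close> comes from stopping short of the line
  \<open>2Q\<close>.\<close>

lemma sixj_kernel_integral_bound:
  assumes "0 < b" "b < 1" "0 < \<eta>" "\<eta> \<le> 1 / 2"
  obtains C where "0 \<le> C"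
    "\<And>x i. i \<in> {1..4} \<Longrightarrow>
       cmod (LINT y|lborel. sixj_kernel b (tau_im x) (kappa_im x) (Complex (7/4 * Qb b) y))
         \<le> C * exp (- pi * Qb b * (1 - \<eta>) * (tau_im x i / 2))"
    "\<And>x k. k \<in> {1..3} \<Longrightarrow>
       cmod (LINT y|lborel. sixj_kernel b (tau_im x) (kappa_im x) (Complex (7/4 * Qb b) y))
         \<le> C * exp (- pi * Qb b * (1 - \<eta>)\<^sup>2 * (x k + x (k + 3)))"
proof -
  define Q where "Q = Qb b"
  have Q: "0 < Q" using assms by (simp add: Q_def Qb_pos)
  \<comment> \<open>With this choice the rate \<open>c - 3Q/2\<close> at
    \<open>c = 2Q - \<delta>\<close> is exactly \<open>(1 - \<eta>) Q/2\<close>.\<close>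
  define \<delta> where "\<delta> = \<eta> * Q / 2"
  have "\<eta> * Q \<le> 1 / 2 * Q" using Q assms by (intro mult_right_mono) auto
  then have \<delta>: "0 < \<delta>" "\<delta> \<le> Q / 4" using Q assms by (auto simp: \<delta>_def)
  obtain C where C: "0 \<le> C" "\<And>\<tau> \<kappa> u. 3/2 * Q + \<delta> \<le> Re u \<Longrightarrow> Re u \<le> 2 * Q - \<delta> \<Longrightarrow>
    cmod (sixj_kernel b \<tau> \<kappa> u) \<le> C * exp (- (pi * (2 * Q - Re u) * (\<Sum>i=1..4. \<bar>Im u - \<tau> i\<bar>) +
       pi * (Re u - 3/2 * Q) * (\<Sum>j=1..4. \<bar>Im u - \<kappa> j\<bar>)))"
    using sixj_kernel_bound[OF assms(1,2) \<delta>(1)] unfolding Q_def by metis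
  let ?I = "\<lambda>x c. LINT y|lborel. sixj_kernel b (tau_im x) (kappa_im x) (Complex c y)"
  \<comment> \<open>The share \<open>\<eta>\<close> of the rate \<open>\<pi> Q/4\<close> on the
    middle line. On the shifted line \<open>\<eta> (1 - \<eta>) \<pi> Q/2\<close> is available,
    which is no smaller because \<open>\<eta> \<le> 1/2\<close>.\<close>
  define a where "a = \<eta> * (pi * (Q / 4))"
  have a: "0 < a" using assms Q by (simp add: a_def)
  define K where "K = C * (LINT y|lborel. exp (- a * \<bar>y\<bar>))"
  have "0 \<le> (LINT y|lborel. exp (- a * \<bar>y::real\<bar>))" by (rule Bochner_Integration.integral_nonneg) simp
  then have K: "0 \<le> K" using C(1) by (simp add: K_def)
  have line: "cmod (?I x c) \<le> K * exp (- m)"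
    if c: "3/2 * Q + \<delta> \<le> c" "c \<le> 2 * Q - \<delta>"
      and m: "\<And>y. m + a * \<bar>y\<bar> \<le> pi * (2 * Q - c) * (\<Sum>i=1..4. \<bar>y - tau_im x i\<bar>) + pi * (c - 3/2 * Q) * (\<Sum>j=1..4. \<bar>y - kappa_im x j\<bar>)"
    for x c m
  proof -
    have "cmod (?I x c) \<le> (C * exp (- m)) * (LINT y|lborel. exp (- a * \<bar>y\<bar>))"
    proof (rule vertical_line_integrable(2)[OF _ a])
      show "continuous_on UNIV (\<lambda>y. sixj_kernel b (tau_im x) (kappa_im x) (Complex c y))"
        by (rule continuous_on_compose2[OF holomorphic_on_imp_continuous_on[OF holomorphic_sixj_kernel[OF assms(1,2)]] continuous_on_Complex_line])
          (use c \<delta> in \<open>auto simp: Q_def\<close>)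
      fix y
      have "cmod (sixj_kernel b (tau_im x) (kappa_im x) (Complex c y)) \<le> C * exp (- (m + a * \<bar>y\<bar>))"
        using C(2)[of "Complex c y" "tau_im x" "kappa_im x"] c m[of y] C(1)
        by (auto elim!: order_trans intro!: mult_left_mono)
      then show "cmod (sixj_kernel b (tau_im x) (kappa_im x) (Complex c y)) \<le> C * exp (- m) * exp (- a * \<bar>y\<bar>)"
        by (simp add: mult.assoc flip: exp_add)
    qed
    then show ?thesis by (simp add: K_def mult_ac)
  qed
  \<comment> \<open>Between the two lines the \<open>\<kappa>\<close> distances keep a rate of at
    least \<open>\<pi> Q/4\<close>, and the one from \<open>0\<close> alone makes the horizontal
    segments vanish.\<close>
  have shift: "?I x (7/4 * Q) = ?I x (2 * Q - \<delta>)" for x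
  proof (rule vertical_line_shift)
    show "sixj_kernel b (tau_im x) (kappa_im x) holomorphic_on {u. 3/2 * Q < Re u \<and> Re u < 2 * Q}"
      unfolding Q_def by (rule holomorphic_sixj_kernel[OF assms(1,2)])
    show "0 < pi * (Q / 4)" using Q by simp
    fix z assume z: "7 / 4 * Q \<le> Re z" "Re z \<le> 2 * Q - \<delta>"
    have s: "0 \<le> (\<Sum>i=1..4. \<bar>Im z - tau_im x i\<bar>)" by (intro sum_nonneg) auto
    have "pi * (Q / 4) * \<bar>Im z\<bar> \<le> pi * (Re z - 3/2 * Q) * (\<Sum>j=1..4. \<bar>Im z - kappa_im x j\<bar>)"
      using z Q sum_dist_kappa_ge_abs[of "Im z" x] by (intro mult_mono) auto
    moreover have "0 \<le> pi * (2 * Q - Re z) * (\<Sum>i=1..4. \<bar>Im z - tau_im x i\<bar>)"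
      using z \<delta> s by (intro mult_nonneg_nonneg) auto
    ultimately have "- (pi * (2 * Q - Re z) * (\<Sum>i=1..4. \<bar>Im z - tau_im x i\<bar>) +
       pi * (Re z - 3/2 * Q) * (\<Sum>j=1..4. \<bar>Im z - kappa_im x j\<bar>)) \<le> - (pi * (Q / 4)) * \<bar>Im z\<bar>"
      unfolding mult_minus_left by (intro le_imp_neg_le add_increasing)
    then have "C * exp (- (pi * (2 * Q - Re z) * (\<Sum>i=1..4. \<bar>Im z - tau_im x i\<bar>) +
       pi * (Re z - 3/2 * Q) * (\<Sum>j=1..4. \<bar>Im z - kappa_im x j\<bar>))) \<le> C * exp (- (pi * (Q / 4)) * \<bar>Im z\<bar>)"
      using C(1) by (intro mult_left_mono) (auto simp only: exp_le_cancel_iff)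
    with C(2)[of z "tau_im x" "kappa_im x"] z \<delta>
    show "cmod (sixj_kernel b (tau_im x) (kappa_im x) z) \<le> C * exp (- (pi * (Q / 4)) * \<bar>Im z\<bar>)"
      by (intro order_trans[OF C(2)]) auto
  qed (use \<delta> Q in auto)
  have 1: "cmod (?I x (7/4 * Q)) \<le> K * exp (- (pi * Q * (1 - \<eta>) * (tau_im x i / 2)))"
    if x: "i \<in> {1..4}" for x i
  proof (rule line)
    fix y
    let ?A = "\<Sum>i=1..4. \<bar>y - tau_im x i\<bar>" and ?B = "\<Sum>j=1..4. \<bar>y - kappa_im x j\<bar>"
    have "0 \<le> ?A" by (intro sum_nonneg) auto
    then have "\<bar>y\<bar> \<le> ?A + ?B" using sum_dist_kappa_ge_abs[of y x] by linarith
    moreover have "2 * tau_im x i \<le> ?A + ?B" by (rule sum_dist_tau_kappa_ge[OF x])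
    ultimately have "(1 - \<eta>) * (2 * tau_im x i) + \<eta> * \<bar>y\<bar> \<le> (1 - \<eta>) * (?A + ?B) + \<eta> * (?A + ?B)"
      using assms by (intro add_mono mult_left_mono) auto
    then have "pi * (Q / 4) * ((1 - \<eta>) * (2 * tau_im x i) + \<eta> * \<bar>y\<bar>) \<le> pi * (Q / 4) * (?A + ?B)"
      using Q by (intro mult_left_mono) (auto simp: algebra_simps)
    then show "pi * Q * (1 - \<eta>) * (tau_im x i / 2) + a * \<bar>y\<bar> \<le>
      pi * (2 * Q - 7 / 4 * Q) * ?A + pi * (7 / 4 * Q - 3 / 2 * Q) * ?B"
      by (simp add: a_def algebra_simps)
  qed (use \<delta> in auto)
  have 2: "cmod (?I x (7/4 * Q)) \<le> K * exp (- (pi * Q * (1 - \<eta>)\<^sup>2 * (x k + x (k + 3))))"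
    if k: "k \<in> {1..3}" for x k
    unfolding shift
  proof (rule line)
    fix y
    let ?A = "\<Sum>i=1..4. \<bar>y - tau_im x i\<bar>" and ?B = "\<Sum>j=1..4. \<bar>y - kappa_im x j\<bar>"
    have A: "0 \<le> ?A" by (intro sum_nonneg) auto
    have "k = 1 \<or> k = 2 \<or> k = 3" using k by auto
    then have "2 * (x k + x (k + 3)) \<le> ?B" using sum_dist_kappa_ge[of x y] by auto
    then have "(1 - \<eta>) * (2 * (x k + x (k + 3))) + \<eta> * \<bar>y\<bar> \<le> (1 - \<eta>) * ?B + \<eta> * ?B"
      using assms sum_dist_kappa_ge_abs[of y x] by (intro add_mono mult_left_mono) auto
    then have "pi * (Q / 2) * (1 - \<eta>) * ((1 - \<eta>) * (2 * (x k + x (k + 3))) + \<eta> * \<bar>y\<bar>) \<le> pi * (Q / 2) * (1 - \<eta>) * ?B"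
      using Q assms by (intro mult_left_mono) (auto simp: algebra_simps)
    moreover have "pi * (Q / 2) * (1 - \<eta>) * ((1 - \<eta>) * (2 * (x k + x (k + 3))) + \<eta> * \<bar>y\<bar>) =
      pi * Q * (1 - \<eta>)\<^sup>2 * (x k + x (k + 3)) + pi * (Q / 2) * (1 - \<eta>) * (\<eta> * \<bar>y\<bar>)"
      by (simp add: power2_eq_square) (simp add: field_simps)
    moreover have "a * \<bar>y\<bar> \<le> pi * (Q / 2) * (1 - \<eta>) * (\<eta> * \<bar>y\<bar>)"
    proof -
      have "1 / 2 * (pi * (Q / 2) * (\<eta> * \<bar>y\<bar>)) \<le> (1 - \<eta>) * (pi * (Q / 2) * (\<eta> * \<bar>y\<bar>))"
        using assms Q by (intro mult_right_mono) auto
      then show ?thesis by (simp add: a_def mult_ac)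
    qed
    \<comment> \<open>On this line the \<open>\<tau>\<close> distances have only the small rate
      \<open>\<pi> \<delta>\<close> and are discarded.\<close>
    moreover have "0 \<le> pi * (2 * Q - (2 * Q - \<delta>)) * ?A" using A \<delta> by simp
    moreover have "pi * (Q / 2) * (1 - \<eta>) * ?B = pi * (2 * Q - \<delta> - 3 / 2 * Q) * ?B"
      by (simp add: \<delta>_def field_simps)
    moreover have "s + u \<le> r + w" if "l \<le> v" "l = s + t" "u \<le> t" "0 \<le> r" "v = w" for s t u r w l v :: real
      using that by linarith
    ultimately show "pi * Q * (1 - \<eta>)\<^sup>2 * (x k + x (k + 3)) + a * \<bar>y\<bar> \<le>
      pi * (2 * Q - (2 * Q - \<delta>)) * ?A + pi * (2 * Q - \<delta> - 3 / 2 * Q) * ?B"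
      by blast
  qed (use \<delta> in auto)
  show ?thesis
    by (rule that[OF K]) (use 1 2 in \<open>auto simp: Q_def\<close>)
qed

text \<open>The differences \<open>q_j - t_i\<close> lie on the line \<open>Re z = Q/2\<close>,
  where the growth rate vanishes, so the prefactor is bounded and the integral decides. A common
  rate for all seven quantities allows the largest of them to be taken as \<open>m\<close>.\<close>

lemma b6j_bound:
  assumes "0 < b" "b < 1" "0 < \<eta>" "\<eta> \<le> 1 / 2"
  shows "\<exists>C\<ge>0. \<forall>x. (\<forall>k\<in>{1..6}. 0 \<le> x k) \<longrightarrow>
     (\<forall>m\<in>{x 1 + x 4, x 2 + x 5, x 3 + x 6, tau_im x 1 / 2, tau_im x 2 / 2, tau_im x 3 / 2, tau_im x 4 / 2}.
     cmod (b6j b (\<lambda>k. Complex (Qb b / 2) (x k))) \<le> C * exp (- pi * Qb b * (1 - \<eta>)\<^sup>2 * m))"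
proof -
  obtain C where C: "0 \<le> C"
    "\<And>x i. i \<in> {1..4} \<Longrightarrow>
       cmod (LINT y|lborel. sixj_kernel b (tau_im x) (kappa_im x) (Complex (7/4 * Qb b) y))
         \<le> C * exp (- pi * Qb b * (1 - \<eta>) * (tau_im x i / 2))"
    "\<And>x k. k \<in> {1..3} \<Longrightarrow>
       cmod (LINT y|lborel. sixj_kernel b (tau_im x) (kappa_im x) (Complex (7/4 * Qb b) y))
         \<le> C * exp (- pi * Qb b * (1 - \<eta>)\<^sup>2 * (x k + x (k + 3)))"
    using sixj_kernel_integral_bound[OF assms] by metis
  have Q: "0 < Qb b" using assms by (simp add: Qb_pos)
  obtain D where D: "0 \<le> D" "\<And>z. Qb b / 2 \<le> Re z \<Longrightarrow> Re z \<le> Qb b - Qb b / 2 \<Longrightarrow>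
    \<bar>Re (log_double_sine b z) + pi * (Qb b / 2 - Re z) * \<bar>Im z\<bar>\<bar> \<le> D"
    using Re_log_double_sine_asymp[OF assms(1,2), of "Qb b / 2"] Q by auto
  \<comment> \<open>Sixteen logarithms of real part at least \<open>- D\<close>, multiplied by
    \<open>- 1/2\<close>, give \<open>8 D\<close>.\<close>
  have pre: "cmod (exp (- (1/2) * (\<Sum>i=1..4. \<Sum>j=1..4. log_double_sine b (Complex (Qb b / 2) (f i j))))) \<le> exp (8 * D)"
    for f :: "nat \<Rightarrow> nat \<Rightarrow> real"
  proof -
    have "\<bar>Re (log_double_sine b (Complex (Qb b / 2) v))\<bar> \<le> D" for v
      using D(2)[of "Complex (Qb b / 2) v"] by simp
    then have "- D \<le> Re (log_double_sine b (Complex (Qb b / 2) v))" for v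
      by (simp add: abs_le_iff minus_le_iff)
    then have "(\<Sum>i=1..(4::nat). \<Sum>j=1..(4::nat). - D) \<le> (\<Sum>i=1..4. \<Sum>j=1..4. Re (log_double_sine b (Complex (Qb b / 2) (f i j))))"
      by (intro sum_mono) auto
    then show ?thesis by simp
  qed
  have le: "cmod (LINT y|lborel. sixj_kernel b (tau_im x) (kappa_im x) (Complex (7/4 * Qb b) y))
      \<le> C * exp (- pi * Qb b * (1 - \<eta>)\<^sup>2 * m)"
    if x: "\<And>k. k \<in> {1..6} \<Longrightarrow> 0 \<le> x k" and
      m: "m \<in> {x 1 + x 4, x 2 + x 5, x 3 + x 6, tau_im x 1 / 2, tau_im x 2 / 2, tau_im x 3 / 2, tau_im x 4 / 2}" for x m
  proof (cases "m \<in> {x 1 + x 4, x 2 + x 5, x 3 + x 6}")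
    case True
    then show ?thesis using C(3)[of 1 x] C(3)[of 2 x] C(3)[of 3 x] by auto
  next
    case False
    with m have "m \<in> (\<lambda>i. tau_im x i / 2) ` {1, 2, 3, 4}" by auto
    then obtain i where i': "i \<in> {1, 2, 3, 4::nat}" and m': "m = tau_im x i / 2" by blast
    then have i: "i \<in> {1..4}" "m = tau_im x i / 2" by auto
    have "0 \<le> tau_im x i"
      using i' x[of 1] x[of 2] x[of 3] x[of 4] x[of 5] x[of 6] by (auto simp: kappa_tau_simps)
    then have "0 \<le> m" using i(2) by simp
    have "(1 - \<eta>)\<^sup>2 \<le> 1 * (1 - \<eta>)" using assms unfolding power2_eq_square by (intro mult_right_mono) auto
    then have "pi * Qb b * (1 - \<eta>)\<^sup>2 * m \<le> pi * Qb b * (1 - \<eta>) * m"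
      using Q \<open>0 \<le> m\<close> by (intro mult_right_mono mult_left_mono) auto
    then have "C * exp (- pi * Qb b * (1 - \<eta>) * m) \<le> C * exp (- pi * Qb b * (1 - \<eta>)\<^sup>2 * m)"
      using C(1) by (intro mult_left_mono) auto
    with C(2)[OF i(1), of x] i(2) show ?thesis by (simp only:)
  qed
  show ?thesis
  proof (intro exI[of _ "exp (8 * D) * C"] conjI allI impI ballI)
    show "0 \<le> exp (8 * D) * C" using C(1) by simp
    fix x :: "nat \<Rightarrow> real" and m assume "\<forall>k\<in>{1..6}. 0 \<le> x k"
      "m \<in> {x 1 + x 4, x 2 + x 5, x 3 + x 6, tau_im x 1 / 2, tau_im x 2 / 2, tau_im x 3 / 2, tau_im x 4 / 2}"
    note bound = le[OF bspec[OF this(1)] this(2)]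
    show "cmod (b6j b (\<lambda>k. Complex (Qb b / 2) (x k))) \<le> exp (8 * D) * C * exp (- pi * Qb b * (1 - \<eta>)\<^sup>2 * m)"
      unfolding b6j_Complex norm_mult mult.assoc[of "exp (8 * D)"]
      by (rule mult_mono[OF pre bound]) auto
  qed
qed

section \<open>Fractional matchings of a tetrahedron\<close>

text \<open>If one value is at least the sum of the other two, replacing the other weights by
  \<open>s\<close> minus its own leaves at most \<open>s\<close> times that value. Otherwise the
  three pair conditions, multiplied by \<open>(y2 + y3 - y1) / 2 \<ge> 0\<close> and its analogues,
  add up to \<open>s (y1 + y2 + y3) / 2\<close>.\<close>

lemma fractional_matching_triangle:
  fixes \<beta>1 \<beta>2 \<beta>3 y1 y2 y3 s m :: real
  assumes "0 \<le> \<beta>1" "0 \<le> \<beta>2" "0 \<le> \<beta>3" "\<beta>1 + \<beta>2 \<le> s" "\<beta>1 + \<beta>3 \<le> s" "\<beta>2 + \<beta>3 \<le> s"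
    and "0 \<le> y1" "0 \<le> y2" "0 \<le> y3" "y1 \<le> m" "y2 \<le> m" "y3 \<le> m" "y1 + y2 + y3 \<le> 2 * m"
  shows "\<beta>1 * y1 + \<beta>2 * y2 + \<beta>3 * y3 \<le> s * m"
proof -
  have s: "0 \<le> s" using assms by linarith
  have dom: "u * x + v * y + w * z \<le> s * m"
    if "y + z \<le> x" "u + v \<le> s" "u + w \<le> s" "0 \<le> y" "0 \<le> z" "x \<le> m" "0 \<le> u" "0 \<le> v" for u v w x y z :: real
  proof -
    have "v * y \<le> (s - u) * y" "w * z \<le> (s - u) * z"
      using that by (intro mult_right_mono; linarith)+
    moreover have "(s - u) * (y + z) \<le> (s - u) * x"
      using that by (intro mult_left_mono; linarith)
    moreover have "s * x \<le> s * m" using s that by (intro mult_left_mono)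
    ultimately show ?thesis by (simp add: algebra_simps)
  qed
  show ?thesis
  proof (cases "y2 + y3 \<le> y1 \<or> y1 + y3 \<le> y2 \<or> y1 + y2 \<le> y3")
    case True
    then show ?thesis
      using dom[of y2 y3 y1 \<beta>1 \<beta>2 \<beta>3] dom[of y1 y3 y2 \<beta>2 \<beta>1 \<beta>3] dom[of y1 y2 y3 \<beta>3 \<beta>1 \<beta>2] assms
      by (auto simp: algebra_simps)
  next
    case False
    then have "(\<beta>2 + \<beta>3) * (y2 + y3 - y1) \<le> s * (y2 + y3 - y1)" "(\<beta>1 + \<beta>3) * (y1 + y3 - y2) \<le> s * (y1 + y3 - y2)"
      "(\<beta>1 + \<beta>2) * (y1 + y2 - y3) \<le> s * (y1 + y2 - y3)"
      using assms by (intro mult_right_mono; linarith)+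
    moreover have "s * (y1 + y2 + y3) \<le> s * (2 * m)" using s assms by (intro mult_left_mono)
    ultimately show ?thesis by (simp add: algebra_simps)
  qed
qed

text \<open>All three edges meet at one vertex, so a single vertex sum bounds the total
  weight.\<close>

lemma fractional_matching_star:
  fixes \<beta>1 \<beta>2 \<beta>3 y1 y2 y3 s m :: real
  assumes "0 \<le> \<beta>1" "0 \<le> \<beta>2" "0 \<le> \<beta>3" "\<beta>1 + \<beta>2 + \<beta>3 \<le> s"
    and "0 \<le> m" "y1 \<le> m" "y2 \<le> m" "y3 \<le> m"
  shows "\<beta>1 * y1 + \<beta>2 * y2 + \<beta>3 * y3 \<le> s * m"
proof -
  have "\<beta>1 * y1 + \<beta>2 * y2 + \<beta>3 * y3 \<le> \<beta>1 * m + \<beta>2 * m + \<beta>3 * m"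
    using assms by (intro add_mono mult_left_mono)
  also have "\<dots> = (\<beta>1 + \<beta>2 + \<beta>3) * m" by (simp add: algebra_simps)
  also have "\<dots> \<le> s * m" using assms by (intro mult_right_mono)
  finally show ?thesis .
qed

text \<open>The maximum of \<open>\<Sum> \<alpha> y\<close> over the angles with vertex sums at most \<open>s\<close> is attained at a perfect
  matching (a pair of opposite edges) or at half a triangle (a face). Subtracting the common part of
  opposite angles leaves weights on three edges, which form either a face or a star.\<close>

lemma fractional_matching_tetrahedron:
  fixes \<alpha> y :: "nat \<Rightarrow> real" and s m :: real
  assumes \<alpha>: "\<And>k. k \<in> {1..6} \<Longrightarrow> 0 \<le> \<alpha> k" and y: "\<And>k. k \<in> {1..6} \<Longrightarrow> 0 \<le> y k"
    and v: "\<alpha> 1 + \<alpha> 3 + \<alpha> 5 \<le> s" "\<alpha> 1 + \<alpha> 2 + \<alpha> 6 \<le> s" "\<alpha> 2 + \<alpha> 3 + \<alpha> 4 \<le> s" "\<alpha> 4 + \<alpha> 5 + \<alpha> 6 \<le> s"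
    and p: "y 1 + y 4 \<le> m" "y 2 + y 5 \<le> m" "y 3 + y 6 \<le> m"
    and f: "y 1 + y 2 + y 3 \<le> 2 * m" "y 1 + y 5 + y 6 \<le> 2 * m" "y 2 + y 4 + y 6 \<le> 2 * m" "y 3 + y 4 + y 5 \<le> 2 * m"
  shows "(\<Sum>k=1..6. \<alpha> k * y k) \<le> s * m"
proof -
  define a where "a = min (\<alpha> 1) (\<alpha> 4)"
  define b where "b = min (\<alpha> 2) (\<alpha> 5)"
  define c where "c = min (\<alpha> 3) (\<alpha> 6)"
  note A = \<alpha>[of 1, simplified] \<alpha>[of 2, simplified] \<alpha>[of 3, simplified] \<alpha>[of 4, simplified] \<alpha>[of 5, simplified] \<alpha>[of 6, simplified]
  note Y = y[of 1, simplified] y[of 2, simplified] y[of 3, simplified] y[of 4, simplified] y[of 5, simplified] y[of 6, simplified]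
  have *: "0 \<le> a" "0 \<le> b" "0 \<le> c" using A by (auto simp: a_def b_def c_def)
  have "a * (y 1 + y 4) \<le> a * m" "b * (y 2 + y 5) \<le> b * m" "c * (y 3 + y 6) \<le> c * m"
    using * p by (intro mult_left_mono; simp)+
  \<comment> \<open>Every vertex lies on exactly one edge of each opposite pair, so all vertex sums
    drop by \<open>a + b + c\<close>, and the bound \<open>s\<close> drops with them.\<close>
  moreover have "(\<alpha> 1 - a) * y 1 + (\<alpha> 4 - a) * y 4 + ((\<alpha> 2 - b) * y 2 + (\<alpha> 5 - b) * y 5) + ((\<alpha> 3 - c) * y 3 + (\<alpha> 6 - c) * y 6)
    \<le> (s - a - b - c) * m"
  proof -
    have a: "a = \<alpha> 1 \<and> a \<le> \<alpha> 4 \<or> a = \<alpha> 4 \<and> a \<le> \<alpha> 1" by (auto simp: a_def)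
    have b: "b = \<alpha> 2 \<and> b \<le> \<alpha> 5 \<or> b = \<alpha> 5 \<and> b \<le> \<alpha> 2" by (auto simp: b_def)
    have c: "c = \<alpha> 3 \<and> c \<le> \<alpha> 6 \<or> c = \<alpha> 6 \<and> c \<le> \<alpha> 3" by (auto simp: c_def)
    note T = fractional_matching_triangle[where s = "s - a - b - c" and m = m]
    note S = fractional_matching_star[where s = "s - a - b - c" and m = m]
    \<comment> \<open>Of the eight choices of a surviving edge in each opposite pair, four are
      faces, settled by \<open>T\<close>, and four are stars, settled by \<open>S\<close>.\<close>
    show ?thesis
      using a
    proof (elim disjE conjE)
      assume a: "a = \<alpha> 4" "a \<le> \<alpha> 1"
      from b show ?thesis
      proof (elim disjE conjE)
        assume b: "b = \<alpha> 5" "b \<le> \<alpha> 2"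
        from c show ?thesis
        proof (elim disjE conjE)
          assume c: "c = \<alpha> 6" "c \<le> \<alpha> 3"
          show ?thesis using T[of "\<alpha> 1 - a" "\<alpha> 2 - b" "\<alpha> 3 - c" "y 1" "y 2" "y 3"] a b c v p f Y by simp
        next
          assume c: "c = \<alpha> 3" "c \<le> \<alpha> 6"
          show ?thesis using S[of "\<alpha> 1 - a" "\<alpha> 2 - b" "\<alpha> 6 - c" "y 1" "y 2" "y 6"] a b c v p f Y by simp
        qed
      next
        assume b: "b = \<alpha> 2" "b \<le> \<alpha> 5"
        from c show ?thesis
        proof (elim disjE conjE)
          assume c: "c = \<alpha> 6" "c \<le> \<alpha> 3"
          show ?thesis using S[of "\<alpha> 1 - a" "\<alpha> 5 - b" "\<alpha> 3 - c" "y 1" "y 5" "y 3"] a b c v p f Y by simp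
        next
          assume c: "c = \<alpha> 3" "c \<le> \<alpha> 6"
          show ?thesis using T[of "\<alpha> 1 - a" "\<alpha> 5 - b" "\<alpha> 6 - c" "y 1" "y 5" "y 6"] a b c v p f Y by simp
        qed
      qed
    next
      assume a: "a = \<alpha> 1" "a \<le> \<alpha> 4"
      from b show ?thesis
      proof (elim disjE conjE)
        assume b: "b = \<alpha> 5" "b \<le> \<alpha> 2"
        from c show ?thesis
        proof (elim disjE conjE)
          assume c: "c = \<alpha> 6" "c \<le> \<alpha> 3"
          show ?thesis using S[of "\<alpha> 4 - a" "\<alpha> 2 - b" "\<alpha> 3 - c" "y 4" "y 2" "y 3"] a b c v p f Y by simp
        next
          assume c: "c = \<alpha> 3" "c \<le> \<alpha> 6"
          show ?thesis using T[of "\<alpha> 4 - a" "\<alpha> 2 - b" "\<alpha> 6 - c" "y 4" "y 2" "y 6"] a b c v p f Y by simp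
        qed
      next
        assume b: "b = \<alpha> 2" "b \<le> \<alpha> 5"
        from c show ?thesis
        proof (elim disjE conjE)
          assume c: "c = \<alpha> 6" "c \<le> \<alpha> 3"
          show ?thesis using T[of "\<alpha> 4 - a" "\<alpha> 5 - b" "\<alpha> 3 - c" "y 4" "y 5" "y 3"] a b c v p f Y by simp
        next
          assume c: "c = \<alpha> 3" "c \<le> \<alpha> 6"
          show ?thesis using S[of "\<alpha> 4 - a" "\<alpha> 5 - b" "\<alpha> 6 - c" "y 4" "y 5" "y 6"] a b c v p f Y by simp
        qed
      qed
    qed
  qed
  moreover have "(\<Sum>k=1..6. \<alpha> k * y k) = \<alpha> 1 * y 1 + \<alpha> 2 * y 2 + \<alpha> 3 * y 3 + \<alpha> 4 * y 4 + \<alpha> 5 * y 5 + \<alpha> 6 * y 6"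
    by (simp add: eval_nat_numeral)
  ultimately show ?thesis by (simp add: algebra_simps)
qed

section \<open>Numbering of the edges of a tetrahedron\<close>

lemma tet_label_image: "tet_label ` {1..6} = {{0, 1}, {1, 2}, {0, 2}, {2, 3}, {0, 3}, {1, 3}}"
proof -
  have "{1..6::nat} = {1, 2, 3, 4, 5, 6}" by auto
  then show ?thesis by (simp add: tet_label_def nth_Cons' insert_commute)
qed

lemma edge_labels_eq: "edge_labels = tet_label ` {1..6}"
  unfolding edge_labels_def tet_label_image
proof (intro set_eqI iffI)
  fix A :: "4 set" assume "A \<in> {A. card A = 2}"
  then obtain x y :: 4 where "A = {x, y}" "x \<noteq> y" by (auto simp: card_2_iff)
  then show "A \<in> {{0, 1}, {1, 2}, {0, 2}, {2, 3}, {0, 3}, {1, 3}}"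
    using exhaust_4[of x] exhaust_4[of y] by (elim disjE) (simp_all add: doubleton_eq_iff)
next
  fix A :: "4 set" assume "A \<in> {{0, 1}, {1, 2}, {0, 2}, {2, 3}, {0, 3}, {1, 3}}"
  then show "A \<in> {A. card A = 2}" by auto
qed

lemma inj_on_tet_label: "inj_on tet_label {1..6}"
proof -
  have i: "{1..6::nat} = {1, 2, 3, 4, 5, 6}" by auto
  show ?thesis unfolding i by (auto simp: inj_on_def tet_label_def nth_Cons' doubleton_eq_iff)
qed

section \<open>Convergence of the state integral\<close>

text \<open>The factor \<open>exp (Q \<Sum> \<alpha> x)\<close> is the part of the growth of the
  edge weights that the angles assign to one tetrahedron. The constants depend on \<open>b\<close>
  and \<open>s\<close> only and so serve all tetrahedra. The four conditions belong to the vertices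
  0, 1, 2, 3 in the numbering of \<open>tet_label\<close>.\<close>

lemma tetrahedron_bound:
  assumes "0 < b" "b < 1" "0 \<le> s" "s < pi"
  shows "\<exists>C \<epsilon>. 0 \<le> C \<and> 0 < \<epsilon> \<and> (\<forall>\<alpha> x. (\<forall>k\<in>{1..6}. 0 \<le> \<alpha> k) \<longrightarrow> (\<forall>k\<in>{1..6}. 0 \<le> x k) \<longrightarrow>
       \<alpha> 1 + \<alpha> 3 + \<alpha> 5 \<le> s \<longrightarrow> \<alpha> 1 + \<alpha> 2 + \<alpha> 6 \<le> s \<longrightarrow> \<alpha> 2 + \<alpha> 3 + \<alpha> 4 \<le> s \<longrightarrow> \<alpha> 4 + \<alpha> 5 + \<alpha> 6 \<le> s \<longrightarrow>
       cmod (b6j b (\<lambda>k. Complex (Qb b / 2) (x k))) * exp (Qb b * (\<Sum>k=1..6. \<alpha> k * x k))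
         \<le> C * exp (- \<epsilon> * (\<Sum>k=1..6. x k)))"
proof -
  \<comment> \<open>Makes \<open>\<pi> (1 - 2 \<eta>)\<close> the midpoint of \<open>s\<close> and
    \<open>\<pi>\<close>: half of the gap covers the loss in rate, the other half is the decay
    \<open>e\<close> that remains.\<close>
  define \<eta> where "\<eta> = (1 - s / pi) / 4"
  have \<eta>: "0 < \<eta>" "\<eta> \<le> 1 / 2" using assms by (auto simp: \<eta>_def field_simps)
  obtain C where C: "0 \<le> C" "\<forall>x. (\<forall>k\<in>{1..6}. 0 \<le> x k) \<longrightarrow>
     (\<forall>m\<in>{x 1 + x 4, x 2 + x 5, x 3 + x 6, tau_im x 1 / 2, tau_im x 2 / 2, tau_im x 3 / 2, tau_im x 4 / 2}.
     cmod (b6j b (\<lambda>k. Complex (Qb b / 2) (x k))) \<le> C * exp (- pi * Qb b * (1 - \<eta>)\<^sup>2 * m))"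
    using b6j_bound[OF assms(1,2) \<eta>] by (elim exE conjE)
  have Q: "0 < Qb b" using assms by (simp add: Qb_pos)
  define e where "e = (pi - s) / 2"
  have e: "0 < e" using assms by (simp add: e_def)
  have "pi * (1 - 2 * \<eta>) \<le> pi * (1 - \<eta>)\<^sup>2"
    by (intro mult_left_mono) (auto simp: power2_eq_square algebra_simps)
  moreover have "pi * (1 - 2 * \<eta>) = s + e" by (simp add: \<eta>_def e_def field_simps)
  ultimately have se: "s + e \<le> pi * (1 - \<eta>)\<^sup>2" by simp
  show ?thesis
  proof (rule exI[of _ C], rule exI[of _ "Qb b * e / 3"], intro conjI allI impI C(1))
    show "0 < Qb b * e / 3" using Q e by simp
    fix \<alpha> x :: "nat \<Rightarrow> real"
    assume \<alpha>: "\<forall>k\<in>{1..6}. 0 \<le> \<alpha> k" and x: "\<forall>k\<in>{1..6}. 0 \<le> x k"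
      and v: "\<alpha> 1 + \<alpha> 3 + \<alpha> 5 \<le> s" "\<alpha> 1 + \<alpha> 2 + \<alpha> 6 \<le> s" "\<alpha> 2 + \<alpha> 3 + \<alpha> 4 \<le> s" "\<alpha> 4 + \<alpha> 5 + \<alpha> 6 \<le> s"
    let ?S = "{x 1 + x 4, x 2 + x 5, x 3 + x 6, tau_im x 1 / 2, tau_im x 2 / 2, tau_im x 3 / 2, tau_im x 4 / 2}"
    define m where "m = Max ?S"
    have m: "m \<in> ?S" unfolding m_def by (rule Max_in) simp_all
    have le: "t \<le> m" if "t \<in> ?S" for t unfolding m_def by (rule Max_ge[OF _ that]) simp
    have p: "x 1 + x 4 \<le> m" "x 2 + x 5 \<le> m" "x 3 + x 6 \<le> m" by (intro le; simp)+
    have "tau_im x 1 / 2 \<le> m" "tau_im x 2 / 2 \<le> m" "tau_im x 3 / 2 \<le> m" "tau_im x 4 / 2 \<le> m" by (intro le; simp)+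
    then have f: "x 1 + x 2 + x 3 \<le> 2 * m" "x 1 + x 5 + x 6 \<le> 2 * m" "x 2 + x 4 + x 6 \<le> 2 * m" "x 3 + x 4 + x 5 \<le> 2 * m"
      by (simp_all add: kappa_tau_simps)
    have sum6: "(\<Sum>k=1..6. x k) = x 1 + x 2 + x 3 + x 4 + x 5 + x 6"
      by (simp add: eval_nat_numeral)
    have m0: "0 \<le> m" using p(1) bspec[OF x, of 1] bspec[OF x, of 4] by simp
    have "(\<Sum>k=1..6. \<alpha> k * x k) \<le> s * m"
      by (rule fractional_matching_tetrahedron[OF bspec[OF \<alpha>] bspec[OF x] v p f])
    then have 1: "Qb b * (\<Sum>k=1..6. \<alpha> k * x k) \<le> Qb b * (s * m)"
      using Q by (intro mult_left_mono) auto
    have "Qb b * m * (s + e) \<le> Qb b * m * (pi * (1 - \<eta>)\<^sup>2)"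
      using Q m0 se by (intro mult_left_mono) auto
    then have 2: "- pi * Qb b * (1 - \<eta>)\<^sup>2 * m + Qb b * (s * m) \<le> - (Qb b * e * m)"
      by (simp add: algebra_simps)
    \<comment> \<open>The edges form three opposite pairs, each with sum at most
      \<open>m\<close>.\<close>
    have "Qb b * e * (\<Sum>k=1..6. x k) \<le> Qb b * e * (3 * m)"
      using Q e p unfolding sum6 by (intro mult_left_mono) auto
    then have 3: "- (Qb b * e * m) \<le> - (Qb b * e / 3) * (\<Sum>k=1..6. x k)" by simp
    have "cmod (b6j b (\<lambda>k. Complex (Qb b / 2) (x k))) * exp (Qb b * (\<Sum>k=1..6. \<alpha> k * x k))
      \<le> C * exp (- pi * Qb b * (1 - \<eta>)\<^sup>2 * m) * exp (Qb b * (s * m))"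
    proof (intro mult_mono)
      show "cmod (b6j b (\<lambda>k. Complex (Qb b / 2) (x k))) \<le> C * exp (- pi * Qb b * (1 - \<eta>)\<^sup>2 * m)"
        by (rule bspec[OF mp[OF spec[OF C(2)] x] m])
      show "exp (Qb b * (\<Sum>k=1..6. \<alpha> k * x k)) \<le> exp (Qb b * (s * m))"
        using 1 by (simp only: exp_le_cancel_iff)
    qed (simp_all add: C(1))
    also have "\<dots> = C * exp (- pi * Qb b * (1 - \<eta>)\<^sup>2 * m + Qb b * (s * m))"
      by (simp only: exp_add mult.assoc)
    also have "\<dots> \<le> C * exp (- (Qb b * e / 3) * (\<Sum>k=1..6. x k))"
      by (rule mult_left_mono[OF iffD2[OF exp_le_cancel_iff order_trans[OF 2 3]] C(1)])
    finally show "cmod (b6j b (\<lambda>k. Complex (Qb b / 2) (x k))) * exp (Qb b * (\<Sum>k=1..6. \<alpha> k * x k))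
         \<le> C * exp (- (Qb b * e / 3) * (\<Sum>k=1..6. x k))" .
  qed
qed

section \<open>Measurability of the weights\<close>

lemma log_double_sine_line_measurable:
  assumes "0 < b" "b < 1" "0 < c" "c < Qb b"
  shows "(\<lambda>v. log_double_sine b (Complex c v)) \<in> borel_measurable borel"
    and "(\<lambda>v. double_sine b (Complex c v)) \<in> borel_measurable borel"
proof -
  have "continuous_on UNIV (\<lambda>v. log_double_sine b (Complex c v))"
    by (rule continuous_on_compose2[OF holomorphic_on_imp_continuous_on[OF holomorphic_log_double_sine[OF assms(1,2)]] continuous_on_Complex_line])
      (use assms in auto)
  then show "(\<lambda>v. log_double_sine b (Complex c v)) \<in> borel_measurable borel"
    by (rule borel_measurable_continuous_onI)
  have "continuous_on UNIV (\<lambda>v. double_sine b (Complex c v))"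
    by (rule continuous_on_compose2[OF holomorphic_on_imp_continuous_on[OF holomorphic_double_sine[OF assms(1,2)]] continuous_on_Complex_line])
      (use assms in auto)
  then show "(\<lambda>v. double_sine b (Complex c v)) \<in> borel_measurable borel"
    by (rule borel_measurable_continuous_onI)
qed

lemma edge_weight_measurable:
  assumes "0 < b" "b < 1" "(\<lambda>y. y e) \<in> borel_measurable M"
  shows "(\<lambda>y. edge_weight b (colour b y e)) \<in> borel_measurable M"
proof -
  define h where "h = (\<lambda>v. log_double_sine b (Complex (1 / b) v))"
  define g where "g = (\<lambda>v. sin (complex_of_real (pi * b) * Complex (1 / b) v))"
  have [measurable]: "h \<in> borel_measurable borel"
    unfolding h_def by (rule log_double_sine_line_measurable) (use assms in \<open>auto simp: Qb_def\<close>)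
  note assms(3)[measurable]
  have [measurable]: "g \<in> borel_measurable borel"
    unfolding g_def by (intro borel_measurable_continuous_onI continuous_intros continuous_on_Complex_line)
  have "edge_weight b (colour b y e) = (cmod (2 * g (2 * y e) * exp (h (2 * y e))))\<^sup>2" for y
  proof -
    have w: "2 * colour b y e - of_real b = Complex (1 / b) (2 * y e)" "Re (2 * colour b y e) = Qb b"
      by (auto simp: complex_eq_iff colour_def Qb_def add_divide_distrib)
    show ?thesis unfolding edge_weight_def double_sine_Re_Qb[OF assms(1) w(2)] w(1) g_def h_def ..
  qed
  then show ?thesis by (simp only:) measurable
qed

text \<open>The symbol is composed of the double sine function and its logarithm on two fixed
  vertical lines, where both are continuous. Its integral depends measurably on the labels because
  the integrand is jointly measurable.\<close>

lemma b6j_measurable: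
  assumes "0 < b" "b < 1" and X: "\<And>k. k \<in> {1..6} \<Longrightarrow> X k \<in> borel_measurable M"
  shows "(\<lambda>s. b6j b (\<lambda>k. Complex (Qb b / 2) (X k s))) \<in> borel_measurable M"
proof -
  have Q: "0 < Qb b" using assms by (simp add: Qb_pos)
  define h where "h = (\<lambda>v. log_double_sine b (Complex (Qb b / 2) v))"
  define g where "g = (\<lambda>v. double_sine b (Complex (Qb b / 4) v))"
  have [measurable]: "h \<in> borel_measurable borel" "g \<in> borel_measurable borel"
    unfolding h_def g_def by (rule log_double_sine_line_measurable; use assms Q in simp)+
  have "X 1 \<in> borel_measurable M" "X 2 \<in> borel_measurable M" "X 3 \<in> borel_measurable M"
    "X 4 \<in> borel_measurable M" "X 5 \<in> borel_measurable M" "X 6 \<in> borel_measurable M"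
    using X by auto
  note [measurable] = this
  define tx where "tx = (\<lambda>i s. tau_im (\<lambda>k. X k s) i)"
  define kx where "kx = (\<lambda>i s. kappa_im (\<lambda>k. X k s) i)"
  have [measurable]: "tx 1 \<in> borel_measurable M" "tx 2 \<in> borel_measurable M" "tx 3 \<in> borel_measurable M" "tx 4 \<in> borel_measurable M"
    "kx 1 \<in> borel_measurable M" "kx 2 \<in> borel_measurable M" "kx 3 \<in> borel_measurable M" "kx 4 \<in> borel_measurable M"
    unfolding tx_def kx_def tau_im_values kappa_im_values by measurable
  \<comment> \<open>On the middle line all eight arguments have real part \<open>Q/4\<close>, so a
    single function \<open>g\<close> describes every factor.\<close>
  have line: "Complex (7/4 * Qb b) y - Complex (3/2 * Qb b) t = Complex (Qb b / 4) (y - t)"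
    "Complex (2 * Qb b) t - Complex (7/4 * Qb b) y = Complex (Qb b / 4) (t - y)" for t y
    by (simp_all add: complex_eq_iff)
  have eq: "b6j b (\<lambda>k. Complex (Qb b / 2) (X k s)) =
     exp (- (1/2) * (\<Sum>i=1..4. \<Sum>j=1..4. h (kx j s - tx i s))) *
     (LINT y|lborel. (\<Prod>i=1..4. g (y - tx i s)) * (\<Prod>j=1..4. g (kx j s - y)))" for s
    unfolding b6j_Complex sixj_kernel_def line h_def g_def tx_def kx_def ..
  have [measurable]: "(\<lambda>z. g (snd z - tx i (fst z))) \<in> borel_measurable (M \<Otimes>\<^sub>M lborel)"
    "(\<lambda>z. g (kx i (fst z) - snd z)) \<in> borel_measurable (M \<Otimes>\<^sub>M lborel)"
    if "tx i \<in> borel_measurable M" "kx i \<in> borel_measurable M" for i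
    using that by measurable
  have "(\<lambda>z. (\<Prod>i=1..4. g (snd z - tx i (fst z))) * (\<Prod>j=1..4. g (kx j (fst z) - snd z))) \<in> borel_measurable (M \<Otimes>\<^sub>M lborel)"
    unfolding prod_1_4 by (intro borel_measurable_times) measurable
  then have [measurable]: "(\<lambda>s. LINT y|lborel. (\<Prod>i=1..4. g (y - tx i s)) * (\<Prod>j=1..4. g (kx j s - y))) \<in> borel_measurable M"
    by (intro lborel.borel_measurable_lebesgue_integral) (simp add: case_prod_beta')
  have "(\<lambda>s. \<Sum>i=1..4. \<Sum>j=1..4. h (kx j s - tx i s)) \<in> borel_measurable M"
    unfolding sum_1_4 by (intro borel_measurable_add) measurable
  then have [measurable]: "(\<lambda>s. exp (- (1/2) * (\<Sum>i=1..4. \<Sum>j=1..4. h (kx j s - tx i s)))) \<in> borel_measurable M"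
    by measurable
  show ?thesis unfolding eq by (intro borel_measurable_times) measurable
qed

section \<open>Summation over corners and the global bound\<close>

lemma sum_vertex_ge:
  fixes f :: "4 set \<Rightarrow> real"
  assumes "\<And>A. A \<in> edge_labels \<Longrightarrow> 0 \<le> f A"
    and ijk: "i \<in> {1..6}" "j \<in> {1..6}" "k \<in> {1..6}" "i \<noteq> j" "i \<noteq> k" "j \<noteq> k"
    and v: "v \<in> tet_label i" "v \<in> tet_label j" "v \<in> tet_label k"
  shows "f (tet_label i) + f (tet_label j) + f (tet_label k) \<le> (\<Sum>A | A \<in> edge_labels \<and> v \<in> A. f A)"
proof -
  have "tet_label i \<noteq> tet_label j" "tet_label i \<noteq> tet_label k" "tet_label j \<noteq> tet_label k"
    using ijk inj_onD[OF inj_on_tet_label] by blast+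
  then have "f (tet_label i) + f (tet_label j) + f (tet_label k) = (\<Sum>A\<in>{tet_label i, tet_label j, tet_label k}. f A)"
    by simp
  also have "\<dots> \<le> (\<Sum>A | A \<in> edge_labels \<and> v \<in> A. f A)"
    using ijk v assms(1) by (intro sum_mono2) (auto simp: edge_labels_eq)
  finally show ?thesis .
qed

lemma sum_edge_labels: "(\<Sum>A\<in>edge_labels. f A) = (\<Sum>k=1..6. f (tet_label k))"
  unfolding edge_labels_eq by (simp only: sum.reindex[OF inj_on_tet_label] o_def)

text \<open>Sums over edges become sums over corners, which are regrouped by tetrahedra. There the
  growth assigned by the angles is absorbed, and a uniform exponential decay is left.\<close>

lemma state_integrand_bound:
  assumes "finite T" "angle_structure T p \<alpha>" "0 < b" "b < 1"
  shows "\<exists>C \<epsilon>. 0 < \<epsilon> \<and> (\<forall>y. (\<forall>e\<in>tri_edges T p. 0 < y e) \<longrightarrow>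
    cmod (state_integrand b T p y) \<le> C * (\<Prod>e\<in>tri_edges T p. exp (- \<epsilon> * y e)))"
proof -
  have \<alpha>: "\<And>c. c \<in> corners T \<Longrightarrow> 0 < \<alpha> c"
    and vertex: "\<And>\<Delta> v. \<Delta> \<in> T \<Longrightarrow> (\<Sum>A | A \<in> edge_labels \<and> v \<in> A. \<alpha> (\<Delta>, A)) < pi"
    and edge: "\<And>e. e \<in> tri_edges T p \<Longrightarrow> (\<Sum>c | c \<in> corners T \<and> edge_at p c = e. \<alpha> c) = 2 * pi"
    using assms(2) by (auto simp: angle_structure_def)
  have fin: "finite (corners T)" "finite (tri_edges T p)"
    using assms(1) by (auto simp: corners_def tri_edges_def)
  let ?V = "\<lambda>(\<Delta>, v). \<Sum>A | A \<in> edge_labels \<and> v \<in> A. \<alpha> (\<Delta>, A)"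
  \<comment> \<open>Inserting \<open>0\<close> keeps the maximum defined for empty \<open>T\<close>
    and makes \<open>s\<close> nonnegative.\<close>
  define s where "s = Max (insert 0 (?V ` (T \<times> UNIV)))"
  have finV: "finite (insert 0 (?V ` (T \<times> UNIV)))" using assms(1) by simp
  have s: "0 \<le> s" "s < pi"
    unfolding s_def using finV vertex by (auto simp: Max_less_iff)
  have s_ge: "(\<Sum>A | A \<in> edge_labels \<and> v \<in> A. \<alpha> (\<Delta>, A)) \<le> s" if "\<Delta> \<in> T" for \<Delta> v
    unfolding s_def by (rule Max_ge[OF finV]) (use that in force)
  obtain C \<epsilon> where C: "0 \<le> C" "0 < \<epsilon>" and bound: "\<forall>\<alpha> x. (\<forall>k\<in>{1..6}. 0 \<le> \<alpha> k) \<longrightarrow> (\<forall>k\<in>{1..6}. 0 \<le> x k) \<longrightarrow>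
       \<alpha> 1 + \<alpha> 3 + \<alpha> 5 \<le> s \<longrightarrow> \<alpha> 1 + \<alpha> 2 + \<alpha> 6 \<le> s \<longrightarrow> \<alpha> 2 + \<alpha> 3 + \<alpha> 4 \<le> s \<longrightarrow> \<alpha> 4 + \<alpha> 5 + \<alpha> 6 \<le> s \<longrightarrow>
       cmod (b6j b (\<lambda>k. Complex (Qb b / 2) (x k))) * exp (Qb b * (\<Sum>k=1..6. \<alpha> k * x k))
         \<le> C * exp (- \<epsilon> * (\<Sum>k=1..6. x k))"
    using tetrahedron_bound[OF assms(3,4) s] by (elim exE conjE)
  obtain K :: real where K: "0 \<le> K" and K_bound: "\<And>(y :: 'b set \<Rightarrow> real) e. 0 < y e \<Longrightarrow> edge_weight b (colour b y e) \<le> K * exp (2 * pi * Qb b * y e)"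
    using edge_weight_bound[OF assms(3,4)] by blast
  let ?C = "K ^ card (tri_edges T p) * C ^ card T"
  have "cmod (state_integrand b T p y) \<le> ?C * (\<Prod>e\<in>tri_edges T p. exp (- \<epsilon> * y e))"
    if y: "\<forall>e\<in>tri_edges T p. 0 < y e" for y
  proof -
    define z where "z = (\<lambda>c. y (edge_at p c))"
    have z: "0 < z c" if "c \<in> corners T" for c using y that by (auto simp: z_def tri_edges_def)
    have corner: "(\<Delta>, tet_label k) \<in> corners T" if "\<Delta> \<in> T" "k \<in> {1..6}" for \<Delta> k
      using that by (simp add: corners_def edge_labels_eq)
    have sum_corners: "(\<Sum>c\<in>corners T. h c) = (\<Sum>\<Delta>\<in>T. \<Sum>k=1..6. h (\<Delta>, tet_label k))" for h :: "'a \<times> 4 set \<Rightarrow> real"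
      unfolding corners_def by (simp add: sum.cartesian_product' sum_edge_labels)
    have "cmod (tet_weight b p (colour b y) \<Delta>) * exp (Qb b * (\<Sum>k=1..6. \<alpha> (\<Delta>, tet_label k) * z (\<Delta>, tet_label k)))
      \<le> C * exp (- \<epsilon> * (\<Sum>k=1..6. z (\<Delta>, tet_label k)))" if \<Delta>: "\<Delta> \<in> T" for \<Delta>
    proof -
      have nn: "0 \<le> \<alpha> (\<Delta>, A)" if "A \<in> edge_labels" for A
        using \<alpha>[of "(\<Delta>, A)"] \<Delta> that by (simp add: corners_def less_imp_le)
      have mem: "0 \<in> tet_label 1" "0 \<in> tet_label 3" "0 \<in> tet_label 5" "1 \<in> tet_label 1" "1 \<in> tet_label 2" "1 \<in> tet_label 6"
        "2 \<in> tet_label 2" "2 \<in> tet_label 3" "2 \<in> tet_label 4" "3 \<in> tet_label 4" "3 \<in> tet_label 5" "3 \<in> tet_label 6"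
        by (simp_all add: tet_label_def nth_Cons')
      have "\<alpha> (\<Delta>, tet_label 1) + \<alpha> (\<Delta>, tet_label 3) + \<alpha> (\<Delta>, tet_label 5) \<le> s"
        by (rule order_trans[OF sum_vertex_ge[where v = 0] s_ge[OF \<Delta>]]) (use nn mem in simp_all)
      moreover have "\<alpha> (\<Delta>, tet_label 1) + \<alpha> (\<Delta>, tet_label 2) + \<alpha> (\<Delta>, tet_label 6) \<le> s"
        by (rule order_trans[OF sum_vertex_ge[where v = 1] s_ge[OF \<Delta>]]) (use nn mem in simp_all)
      moreover have "\<alpha> (\<Delta>, tet_label 2) + \<alpha> (\<Delta>, tet_label 3) + \<alpha> (\<Delta>, tet_label 4) \<le> s"
        by (rule order_trans[OF sum_vertex_ge[where v = 2] s_ge[OF \<Delta>]]) (use nn mem in simp_all)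
      moreover have "\<alpha> (\<Delta>, tet_label 4) + \<alpha> (\<Delta>, tet_label 5) + \<alpha> (\<Delta>, tet_label 6) \<le> s"
        by (rule order_trans[OF sum_vertex_ge[where v = 3] s_ge[OF \<Delta>]]) (use nn mem in simp_all)
      moreover have "\<forall>k\<in>{1..6}. 0 \<le> \<alpha> (\<Delta>, tet_label k)" "\<forall>k\<in>{1..6}. 0 \<le> z (\<Delta>, tet_label k)"
        using \<alpha>[OF corner[OF \<Delta>]] z[OF corner[OF \<Delta>]] by (auto intro: less_imp_le)
      moreover have "tet_weight b p (colour b y) \<Delta> = b6j b (\<lambda>k. Complex (Qb b / 2) (z (\<Delta>, tet_label k)))"
        by (simp add: tet_weight_def colour_def z_def)
      ultimately show ?thesis
        using bound[rule_format, of "\<lambda>k. \<alpha> (\<Delta>, tet_label k)" "\<lambda>k. z (\<Delta>, tet_label k)"] by simp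
    qed
    then have "(\<Prod>\<Delta>\<in>T. cmod (tet_weight b p (colour b y) \<Delta>) * exp (Qb b * (\<Sum>k=1..6. \<alpha> (\<Delta>, tet_label k) * z (\<Delta>, tet_label k))))
      \<le> (\<Prod>\<Delta>\<in>T. C * exp (- \<epsilon> * (\<Sum>k=1..6. z (\<Delta>, tet_label k))))"
      by (intro prod_mono) auto
    moreover have "(\<Prod>\<Delta>\<in>T. C * exp (- \<epsilon> * (\<Sum>k=1..6. z (\<Delta>, tet_label k)))) = C ^ card T * exp (- \<epsilon> * (\<Sum>c\<in>corners T. z c))"
      by (simp only: prod.distrib prod_constant exp_sum[OF assms(1), symmetric] sum_distrib_left[symmetric] sum_corners)
    moreover have "(\<Prod>\<Delta>\<in>T. cmod (tet_weight b p (colour b y) \<Delta>) * exp (Qb b * (\<Sum>k=1..6. \<alpha> (\<Delta>, tet_label k) * z (\<Delta>, tet_label k))))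
      = (\<Prod>\<Delta>\<in>T. cmod (tet_weight b p (colour b y) \<Delta>)) * exp (Qb b * (\<Sum>c\<in>corners T. \<alpha> c * z c))"
      by (simp only: prod.distrib exp_sum[OF assms(1), symmetric] sum_distrib_left[symmetric] sum_corners)
    ultimately have tets: "(\<Prod>\<Delta>\<in>T. cmod (tet_weight b p (colour b y) \<Delta>)) * exp (Qb b * (\<Sum>c\<in>corners T. \<alpha> c * z c))
      \<le> C ^ card T * exp (- \<epsilon> * (\<Sum>c\<in>corners T. z c))" by simp
    have ew: "0 \<le> edge_weight b a" for a by (simp add: edge_weight_def)
    have "(\<Prod>e\<in>tri_edges T p. edge_weight b (colour b y e)) \<le> (\<Prod>e\<in>tri_edges T p. K * exp (2 * pi * Qb b * y e))"
      using K_bound y ew by (intro prod_mono) auto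
    also have "\<dots> = K ^ card (tri_edges T p) * exp (\<Sum>e\<in>tri_edges T p. 2 * pi * Qb b * y e)"
      by (simp only: prod.distrib prod_constant exp_sum[OF fin(2)])
    \<comment> \<open>Here the factor \<open>2 \<pi>\<close> is replaced by the sum of the angles
      around the edge.\<close>
    also have "(\<Sum>e\<in>tri_edges T p. 2 * pi * Qb b * y e) = Qb b * (\<Sum>e\<in>tri_edges T p. (\<Sum>c | c \<in> corners T \<and> edge_at p c = e. \<alpha> c * z c))"
    proof -
      have "2 * pi * Qb b * y e = Qb b * (\<Sum>c | c \<in> corners T \<and> edge_at p c = e. \<alpha> c * z c)" if "e \<in> tri_edges T p" for e
      proof -
        have "(\<Sum>c | c \<in> corners T \<and> edge_at p c = e. \<alpha> c * z c) = (\<Sum>c | c \<in> corners T \<and> edge_at p c = e. \<alpha> c) * y e"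
          unfolding sum_distrib_right by (intro sum.cong) (auto simp: z_def)
        then show ?thesis using edge[OF that] by simp
      qed
      then show ?thesis by (simp add: sum_distrib_left)
    qed
    also have "(\<Sum>e\<in>tri_edges T p. (\<Sum>c | c \<in> corners T \<and> edge_at p c = e. \<alpha> c * z c)) = (\<Sum>c\<in>corners T. \<alpha> c * z c)"
      unfolding tri_edges_def using sum.image_gen[OF fin(1), of "\<lambda>c. \<alpha> c * z c" "edge_at p"] by simp
    finally have edges: "(\<Prod>e\<in>tri_edges T p. edge_weight b (colour b y e)) \<le>
      K ^ card (tri_edges T p) * exp (Qb b * (\<Sum>c\<in>corners T. \<alpha> c * z c))" .
    \<comment> \<open>Every edge has at least one corner and all labels are positive, so decay over
      corners implies decay over edges.\<close>
    have "(\<Sum>e\<in>tri_edges T p. y e) \<le> (\<Sum>c\<in>corners T. z c)"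
      unfolding tri_edges_def z_def
      using sum_image_le[OF fin(1), of y "edge_at p"] y by (auto simp: tri_edges_def o_def less_imp_le)
    then have ez: "exp (- \<epsilon> * (\<Sum>c\<in>corners T. z c)) \<le> (\<Prod>e\<in>tri_edges T p. exp (- \<epsilon> * y e))"
      using C(2) by (simp add: exp_sum[OF fin(2), symmetric] sum_negf flip: sum_distrib_left)
    have "cmod (state_integrand b T p y) = (\<Prod>e\<in>tri_edges T p. edge_weight b (colour b y e)) * (\<Prod>\<Delta>\<in>T. cmod (tet_weight b p (colour b y) \<Delta>))"
      using ew by (simp add: state_integrand_def norm_mult prod_norm[symmetric] prod_nonneg)
    also have "\<dots> \<le> K ^ card (tri_edges T p) * exp (Qb b * (\<Sum>c\<in>corners T. \<alpha> c * z c)) * (\<Prod>\<Delta>\<in>T. cmod (tet_weight b p (colour b y) \<Delta>))"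
      by (intro mult_right_mono edges prod_nonneg) auto
    also have "\<dots> = K ^ card (tri_edges T p) * ((\<Prod>\<Delta>\<in>T. cmod (tet_weight b p (colour b y) \<Delta>)) * exp (Qb b * (\<Sum>c\<in>corners T. \<alpha> c * z c)))"
      by (simp only: mult_ac)
    also have "\<dots> \<le> K ^ card (tri_edges T p) * (C ^ card T * exp (- \<epsilon> * (\<Sum>c\<in>corners T. z c)))"
      using K by (intro mult_left_mono tets) auto
    also have "\<dots> \<le> K ^ card (tri_edges T p) * (C ^ card T * (\<Prod>e\<in>tri_edges T p. exp (- \<epsilon> * y e)))"
      using K C by (intro mult_left_mono ez) auto
    finally show ?thesis by (simp only: mult.assoc)
  qed
  then show ?thesis using C(2) by blast
qed

lemma state_integrand_measurable:
  assumes "finite T" "0 < b" "b < 1"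
  shows "state_integrand b T p \<in> borel_measurable (Pi\<^sub>M (tri_edges T p) (\<lambda>_. lborel))"
proof -
  let ?M = "Pi\<^sub>M (tri_edges T p) (\<lambda>_. lborel :: real measure)"
  have comp: "(\<lambda>y. y e) \<in> borel_measurable ?M" if "e \<in> tri_edges T p" for e
    using measurable_component_singleton[OF that, of "\<lambda>_. lborel"] by simp
  have edge: "edge_at p (\<Delta>, tet_label k) \<in> tri_edges T p" if "\<Delta> \<in> T" "k \<in> {1..6}" for \<Delta> k
    using that by (auto simp: tri_edges_def corners_def edge_labels_eq)
  have [measurable]: "(\<lambda>y. \<Prod>e\<in>tri_edges T p. edge_weight b (colour b y e)) \<in> borel_measurable ?M"
    by (intro borel_measurable_prod edge_weight_measurable[OF assms(2,3)] comp)
  have [measurable]: "(\<lambda>y. \<Prod>\<Delta>\<in>T. tet_weight b p (colour b y) \<Delta>) \<in> borel_measurable ?M"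
    unfolding tet_weight_def colour_def
    by (intro borel_measurable_prod b6j_measurable[OF assms(2,3)] comp edge)
  show ?thesis
    unfolding state_integrand_def [abs_def] by measurable
qed

theorem theorem4p1:
  fixes M :: "'m set" and d :: "'m \<Rightarrow> 'm \<Rightarrow> real"
    and T :: "'t set" and g :: "'t \<times> 4 \<Rightarrow> 't \<times> 4"
    and \<phi> :: "'t \<times> 4 \<Rightarrow> real^4 \<Rightarrow> real^4"
    and p :: "'t \<times> (real^4) \<Rightarrow> 'm"
    and b :: real
  assumes "hyperbolic_3mfd_geodesic_boundary M d"
    and "ideal_triangulation (Metric_space.mtopology M d) T g \<phi> p"
    and "\<exists>\<alpha>. angle_structure T p \<alpha>"
    and "0 < b" and "b < 1"
  shows "set_integrable (Pi\<^sub>M (tri_edges T p) (\<lambda>_. lborel))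
           (tri_edges T p \<rightarrow>\<^sub>E {0<..})
           (state_integrand b T p)"
proof -
  let ?E = "tri_edges T p"
  let ?M = "Pi\<^sub>M ?E (\<lambda>_. lborel :: real measure)"
  have T: "finite T" using assms(2) by (simp add: ideal_triangulation_def)
  then have E: "finite ?E" by (auto simp: tri_edges_def corners_def)
  obtain \<alpha> where "angle_structure T p \<alpha>" using assms(3) by blast
  then obtain C \<epsilon> where \<epsilon>: "0 < \<epsilon>" and bound: "\<And>y. (\<forall>e\<in>?E. 0 < y e) \<Longrightarrow>
      cmod (state_integrand b T p y) \<le> C * (\<Prod>e\<in>?E. exp (- \<epsilon> * y e))"
    using state_integrand_bound[OF T _ assms(4,5)] by blast
  interpret product_sigma_finite "\<lambda>_. lborel :: real measure"
    by (simp add: product_sigma_finite_def sigma_finite_lborel)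
  \<comment> \<open>The absolute values make the majorant integrable over the whole product space,
    one variable at a time; on the domain of integration they change nothing.\<close>
  have "integrable ?M (\<lambda>y. \<Prod>e\<in>?E. exp (- \<epsilon> * \<bar>y e\<bar>))"
    by (intro product_integrable_prod E integrable_exp_abs \<epsilon>)
  then have int: "integrable ?M (\<lambda>y. C * (\<Prod>e\<in>?E. exp (- \<epsilon> * \<bar>y e\<bar>)))"
    by (rule integrable_mult_right)
  have meas: "?E \<rightarrow>\<^sub>E {0<..} \<in> sets ?M"
    using E by (intro sets_PiM_I_finite) auto
  show ?thesis
    unfolding set_integrable_def
  proof (rule Bochner_Integration.integrable_bound[OF int])
    show "(\<lambda>y. indicator (?E \<rightarrow>\<^sub>E {0<..}) y *\<^sub>R state_integrand b T p y) \<in> borel_measurable ?M"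
      using meas state_integrand_measurable[OF T assms(4,5)]
      by (intro borel_measurable_scaleR borel_measurable_indicator)
    show "AE y in ?M. cmod (indicator (?E \<rightarrow>\<^sub>E {0<..}) y *\<^sub>R state_integrand b T p y)
        \<le> norm (C * (\<Prod>e\<in>?E. exp (- \<epsilon> * \<bar>y e\<bar>)))"
    proof (intro always_eventually allI)
      fix y
      show "cmod (indicator (?E \<rightarrow>\<^sub>E {0<..}) y *\<^sub>R state_integrand b T p y)
        \<le> norm (C * (\<Prod>e\<in>?E. exp (- \<epsilon> * \<bar>y e\<bar>)))"
      proof (cases "y \<in> ?E \<rightarrow>\<^sub>E {0<..}")
        case True
        then have y: "\<forall>e\<in>?E. 0 < y e" by (auto simp: PiE_def Pi_def)
        have "cmod (state_integrand b T p y) \<le> C * (\<Prod>e\<in>?E. exp (- \<epsilon> * \<bar>y e\<bar>))"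
          using bound[OF y] y by (simp add: abs_of_pos cong: prod.cong)
        also have "\<dots> \<le> norm (C * (\<Prod>e\<in>?E. exp (- \<epsilon> * \<bar>y e\<bar>)))" by simp
        finally show ?thesis using True by simp
      qed simp
    qed
  qed
qed

end
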